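(* Let $P=(X,\prec)$ be a finite poset, let $z_1\prec z_2\prec z_3$ be distinct elements of $X$, let $A=\{z_1,z_2,z_3\}$, and let $t\ge 1$ be an integer such that $P$ is either $t$-thin or $t$-flat with respect to $A$. Let $k,\ell\ge1$ be integers and let $\mathrm{F}(a,b)$ be the number of linear extensions $L$ of $P$ with $L(z_2)-L(z_1)=a$ and $L(z_3)-L(z_2)=b$. Suppose that $\mathrm{F}(k,\ell+2)=0$ and $\mathrm{F}(k+2,\ell)>0$. Then $$\mathrm{F}(k+1,\ell)\,\mathrm{F}(k,\ell+1)\ \ge\ \mathrm{F}(k,\ell)\,\mathrm{F}(k+1,\ell+1)\cdot\max\Big\{\tfrac12+\tfrac{1}{16k\ell(\ell+1)t},\ \tfrac12+\tfrac{1}{16t(t+1)^3}\Big\}.$$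
   Context: A linear extension of a finite poset $P=(X,\prec)$ with $|X|=n$ is a bijection $L:X\to\{1,\dots,n\}$ with $L(u)<L(v)$ whenever $u\prec v$. $P$ is $t$-thin with respect to $A$ if every $u\in X\setminus A$ is incomparable to at most $t$ elements of $X$; $P$ is $t$-flat with respect to $A$ if every $u\in A$ is comparable to at most $t$ elements of $X$. *)

theory Defs
  imports Complex_Main "HOL-Library.FuncSet"
begin

definition finite_strict_poset :: "'a set \<Rightarrow> ('a \<Rightarrow> 'a \<Rightarrow> bool) \<Rightarrow> bool" where
  "finite_strict_poset X lt \<longleftrightarrow> finite X \<and> irreflp_on X lt \<and> transp_on X lt"

text \<open>Functions are made extensional outside \<open>X\<close>, so that cardinalities count maps on \<open>X\<close>.\<close>

definition linear_extensions :: "'a set \<Rightarrow> ('a \<Rightarrow> 'a \<Rightarrow> bool) \<Rightarrow> ('a \<Rightarrow> nat) set" where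
  "linear_extensions X lt =
    {L \<in> X \<rightarrow>\<^sub>E {1..card X}. bij_betw L X {1..card X} \<and>
       (\<forall>u\<in>X. \<forall>v\<in>X. lt u v \<longrightarrow> L u < L v)}"

text \<open>Both relations are irreflexive: an element counts neither as comparable nor as
  incomparable to itself.  For flatness this is the weaker hypothesis of the two possible
  conventions.\<close>

definition comparable :: "('a \<Rightarrow> 'a \<Rightarrow> bool) \<Rightarrow> 'a \<Rightarrow> 'a \<Rightarrow> bool" where
  "comparable lt u v \<longleftrightarrow> lt u v \<or> lt v u"

definition incomparable :: "('a \<Rightarrow> 'a \<Rightarrow> bool) \<Rightarrow> 'a \<Rightarrow> 'a \<Rightarrow> bool" where
  "incomparable lt u v \<longleftrightarrow> u \<noteq> v \<and> \<not> lt u v \<and> \<not> lt v u"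

definition thin_wrt :: "'a set \<Rightarrow> ('a \<Rightarrow> 'a \<Rightarrow> bool) \<Rightarrow> nat \<Rightarrow> 'a set \<Rightarrow> bool" where
  "thin_wrt X lt t A \<longleftrightarrow> (\<forall>u\<in>X - A. card {v \<in> X. incomparable lt u v} \<le> t)"

definition flat_wrt :: "'a set \<Rightarrow> ('a \<Rightarrow> 'a \<Rightarrow> bool) \<Rightarrow> nat \<Rightarrow> 'a set \<Rightarrow> bool" where
  "flat_wrt X lt t A \<longleftrightarrow> (\<forall>u\<in>A. card {v \<in> X. comparable lt u v} \<le> t)"

definition gap_count ::
  "'a set \<Rightarrow> ('a \<Rightarrow> 'a \<Rightarrow> bool) \<Rightarrow> 'a \<Rightarrow> 'a \<Rightarrow> 'a \<Rightarrow> nat \<Rightarrow> nat \<Rightarrow> nat" where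
  "gap_count X lt z1 z2 z3 a b =
    card {L \<in> linear_extensions X lt.
      int (L z2) - int (L z1) = int a \<and> int (L z3) - int (L z2) = int b}"

end

theory Submission
  imports Defs "Jordan_Normal_Form.Determinant"
begin

text \<open>
  If \<open>F k (l + 2) = 0\<close> while \<open>F k l\<close> and \<open>F (k + 1) (l + 1)\<close> are positive, then exactly \<open>l\<close>
  elements are neither below \<open>z2\<close> nor above \<open>z3\<close> (nor equal to one of them).  So a gap of \<open>l + 1\<close>
  forces all of them between \<open>z2\<close> and \<open>z3\<close>, and the elements before \<open>z2\<close> form the set \<open>Q\<close> of
  elements below \<open>z2\<close>; a gap of \<open>l\<close> leaves one of them free, and the elements before \<open>z2\<close> form \<open>Q\<close>
  or \<open>Q\<close> with one additional maximal element \<open>x\<close>.  Sorting linear extensions by the part from \<open>z2\<close>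
  on reduces the claim to counts of linear extensions of \<open>T = Q \<union> {x}\<close> and of \<open>Q\<close> with a prescribed
  number of elements after \<open>z1\<close>.

  For those counts an Alexandrov--Fenchel inequality is available: the form whose entries count
  linear extensions after two elements have been removed at the ends of the order is hyperbolic.
  This is shown by induction with the Bochner method.  Applied to the removal of a last element,
  the removal of a first element and the removal of \<open>x\<close> it gives
  \<open>(c d - a b)\<^sup>2 \<le> (a\<^sup>2 - p c) b\<^sup>2\<close>, where \<open>p\<close>, \<open>a\<close>, \<open>c\<close> are three consecutive counts for \<open>T\<close> and \<open>d\<close>,
  \<open>b\<close> two consecutive counts for \<open>Q\<close>.  Moving a single element across \<open>z1\<close> bounds \<open>a\<^sup>2 / (p c)\<close> by
  \<open>min k t * t\<close> and so improves the trivial constant \<open>1/2\<close>.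
\<close>

section \<open>Hyperbolic quadratic forms\<close>

text \<open>An enumeration of \<open>I\<close> turns the system into a square matrix; a trivial
  kernel means a nonzero determinant and hence an inverse. This is what inverts the Laplacian
  below.\<close>

lemma injective_system_solvable:
  fixes L :: "'i \<Rightarrow> 'i \<Rightarrow> real" and r :: "'i \<Rightarrow> real"
  assumes fin: "finite I"
    and inj: "\<And>y. (\<And>i. i \<in> I \<Longrightarrow> (\<Sum>j\<in>I. L i j * y j) = 0) \<Longrightarrow> (\<And>i. i \<in> I \<Longrightarrow> y i = 0)"
  obtains y where "\<And>i. i \<in> I \<Longrightarrow> (\<Sum>j\<in>I. L i j * y j) = r i"
proof -
  define n where "n = card I"
  obtain f where f: "bij_betw f {0..<n} I"
    using ex_bij_betw_nat_finite[OF fin] n_def by blast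
  define g where "g = the_inv_into {0..<n} f"
  have g: "g i \<in> {0..<n}" "f (g i) = i" if "i \<in> I" for i
    using that f unfolding g_def
    by (metis bij_betw_def bij_betw_the_inv_into imageI, metis bij_betw_def f_the_inv_into_f)
  have gf: "g (f a) = a" if "a < n" for a
    using that f unfolding g_def by (simp add: bij_betw_def the_inv_into_f_f)
  define A where "A = mat n n (\<lambda>(a, b). L (f a) (f b))"
  have A: "A \<in> carrier_mat n n" by (simp add: A_def)
  have A_apply: "(A *\<^sub>v v) $ a = (\<Sum>j\<in>I. L (f a) j * v $ g j)" if "a < n" "v \<in> carrier_vec n" for a v
  proof -
    have "(A *\<^sub>v v) $ a = (\<Sum>b = 0..<n. L (f a) (f b) * v $ b)"
      using that by (auto simp: A_def scalar_prod_def)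
    also have "\<dots> = (\<Sum>b = 0..<n. L (f a) (f b) * v $ g (f b))"
      by (intro sum.cong) (auto simp: gf)
    also have "\<dots> = (\<Sum>j\<in>I. L (f a) j * v $ g j)"
      by (rule sum.reindex_bij_betw[OF f])
    finally show ?thesis .
  qed
  have "det A \<noteq> 0"
  proof
    assume "det A = 0"
    then obtain v where v: "v \<in> carrier_vec n" "v \<noteq> 0\<^sub>v n" "A *\<^sub>v v = 0\<^sub>v n"
      using det_0_iff_vec_prod_zero[OF A] by blast
    have "v $ g i = 0" if "i \<in> I" for i
    proof (rule inj[of "\<lambda>i. v $ g i", OF _ that])
      fix i assume "i \<in> I"
      then show "(\<Sum>j\<in>I. L i j * v $ g j) = 0"
        using A_apply[of "g i" v] g[of i] v by simp
    qed
    then have "v $ a = 0" if "a < n" for a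
      using that gf[of a] bij_betwE[OF f] by (metis atLeastLessThan_iff zero_le)
    then show False using v by (auto intro: eq_vecI)
  qed
  then have "A \<in> Units (ring_mat TYPE(real) n ())"
    by (rule det_non_zero_imp_unit[OF A])
  then obtain B where B: "B \<in> carrier_mat n n" "A * B = 1\<^sub>m n"
    unfolding Units_def ring_mat_def by auto
  define w where "w = vec n (\<lambda>a. r (f a))"
  have w: "w \<in> carrier_vec n" by (simp add: w_def)
  have "A *\<^sub>v (B *\<^sub>v w) = w"
    using assoc_mult_mat_vec[OF A B(1) w] B(2) w by simp
  moreover have "(A *\<^sub>v (B *\<^sub>v w)) $ g i = (\<Sum>j\<in>I. L i j * (B *\<^sub>v w) $ g j)" if "i \<in> I" for i
    using A_apply[of "g i" "B *\<^sub>v w"] g[OF that] B w by simp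
  moreover have "w $ g i = r i" if "i \<in> I" for i using g[OF that] by (simp add: w_def)
  ultimately have "(\<Sum>j\<in>I. L i j * (B *\<^sub>v w) $ g j) = r i" if "i \<in> I" for i
    using that by metis
  then show ?thesis by (rule that[of "\<lambda>j. (B *\<^sub>v w) $ g j"])
qed

section \<open>Symmetric forms and the reversed Cauchy-Schwarz inequality\<close>

definition quad :: "'i set \<Rightarrow> ('i \<Rightarrow> 'i \<Rightarrow> real) \<Rightarrow> ('i \<Rightarrow> real) \<Rightarrow> ('i \<Rightarrow> real) \<Rightarrow> real" where
  "quad I m x y = (\<Sum>i\<in>I. \<Sum>j\<in>I. m i j * x i * y j)"

lemma quad_commute:
  assumes "\<And>i j. i \<in> I \<Longrightarrow> j \<in> I \<Longrightarrow> m i j = m j i"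
  shows "quad I m x y = quad I m y x"
  unfolding quad_def
  by (subst sum.swap) (intro sum.cong refl, simp add: assms mult_ac)

lemma quad_lin_left: "quad I m (\<lambda>i. s * x i + t * y i) w = s * quad I m x w + t * quad I m y w"
  by (simp add: quad_def sum_distrib_left sum.distrib[symmetric] algebra_simps)

lemma quad_lin_right: "quad I m w (\<lambda>i. s * x i + t * y i) = s * quad I m w x + t * quad I m w y"
  by (simp add: quad_def sum_distrib_left sum.distrib[symmetric] algebra_simps)

text \<open>For a symmetric \<open>quad\<close> form this amounts to having at most one positive
  eigenvalue. Restricting the inequality to positive vectors admits negative semidefinite
  forms.\<close>

definition hyperbolic :: "(('i \<Rightarrow> real) \<Rightarrow> ('i \<Rightarrow> real) \<Rightarrow> real) \<Rightarrow> bool" where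
  "hyperbolic B \<longleftrightarrow> (\<forall>x y. B x x > 0 \<longrightarrow> B y y > 0 \<longrightarrow> B x x * B y y \<le> (B x y)\<^sup>2)"

text \<open>Some combination of \<open>x\<close> and \<open>y\<close> is orthogonal to
  \<open>h\<close>, so the form is not positive definite on their span; completing the square turns
  this into the sign of the discriminant.\<close>

lemma hyperbolicI_orthogonal:
  assumes sym: "\<And>i j. i \<in> I \<Longrightarrow> j \<in> I \<Longrightarrow> m i j = m j i"
    and neg: "\<And>v. quad I m v h = 0 \<Longrightarrow> quad I m v v \<le> 0"
  shows "hyperbolic (quad I m)"
  unfolding hyperbolic_def
proof (intro allI impI)
  fix x y assume pos: "quad I m x x > 0" "quad I m y y > 0"
  define a where "a = quad I m x h"
  define b where "b = quad I m y h"
  have a0: "a \<noteq> 0" using neg[of x] pos by (auto simp: a_def)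
  define v where "v = (\<lambda>i. b * x i + (- a) * y i)"
  have "quad I m v h = 0" by (simp only: v_def quad_lin_left) (simp add: a_def b_def)
  then have "quad I m v v \<le> 0" by (rule neg)
  moreover have "quad I m v v = b\<^sup>2 * quad I m x x - 2 * a * b * quad I m x y + a\<^sup>2 * quad I m y y"
    unfolding v_def quad_lin_left quad_lin_right
    using quad_commute[where I = I and m = m and x = y and y = x, OF sym] by (simp add: power2_eq_square algebra_simps)
  ultimately have le: "b\<^sup>2 * quad I m x x - 2 * a * b * quad I m x y + a\<^sup>2 * quad I m y y \<le> 0" by simp
  have "a\<^sup>2 * (quad I m x x * quad I m y y - (quad I m x y)\<^sup>2)
      \<le> (b * quad I m x x - a * quad I m x y)\<^sup>2 + a\<^sup>2 * (quad I m x x * quad I m y y - (quad I m x y)\<^sup>2)"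
    by simp
  also have "\<dots> = quad I m x x * (b\<^sup>2 * quad I m x x - 2 * a * b * quad I m x y + a\<^sup>2 * quad I m y y)"
    by (simp add: power2_eq_square algebra_simps)
  also have "\<dots> \<le> 0" using le pos by (simp add: mult_nonneg_nonpos)
  finally show "quad I m x x * quad I m y y \<le> (quad I m x y)\<^sup>2"
    using a0 by (simp add: mult_le_0_iff)
qed

text \<open>Subtracting multiples of \<open>w\<close> moves \<open>x\<close> and \<open>y\<close> into the orthogonal complement of \<open>w\<close>,
  where the form is negative semidefinite; the claim is Cauchy--Schwarz there.\<close>

lemma hyperbolic_triple:
  assumes sym: "\<And>i j. i \<in> I \<Longrightarrow> j \<in> I \<Longrightarrow> m i j = m j i"
    and hyp: "hyperbolic (quad I m)" and pos: "quad I m w w > 0"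
  shows "(quad I m w w * quad I m x y - quad I m x w * quad I m y w)\<^sup>2
    \<le> ((quad I m x w)\<^sup>2 - quad I m x x * quad I m w w) * ((quad I m y w)\<^sup>2 - quad I m y y * quad I m w w)"
proof -
  define c where "c = quad I m w w"
  define a where "a = quad I m x w"
  define b where "b = quad I m y w"
  define d where "d = c * quad I m x y - a * b"
  define P where "P = a\<^sup>2 - quad I m x x * c"
  define R where "R = b\<^sup>2 - quad I m y y * c"
  have qc: "quad I m u v = quad I m v u" for u v by (rule quad_commute[OF sym])
  have c: "c > 0" using pos by (simp add: c_def)
  have le: "s\<^sup>2 * P - 2 * s * t * d + t\<^sup>2 * R \<ge> 0" for s t
  proof -
    \<comment> \<open>\<open>c * x - a * w\<close> and \<open>c * y - b * w\<close> are the
      projections of \<open>x\<close> and \<open>y\<close> off \<open>w\<close>, cleared of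
      denominators.\<close>
    define v where "v = (\<lambda>i. 1 * (s * (c * x i + (- a) * w i) + t * (c * y i + (- b) * w i)) + 0 * w i)"
    have vw: "quad I m v w = 0"
      by (simp only: v_def quad_lin_left) (simp add: a_def b_def c_def)
    have "quad I m v v \<le> 0"
    proof (rule ccontr)
      assume "\<not> quad I m v v \<le> 0"
      then have "quad I m v v * quad I m w w \<le> (quad I m v w)\<^sup>2" "quad I m v v > 0"
        using hyp pos by (auto simp: hyperbolic_def)
      then show False using vw pos by (simp add: mult_le_0_iff)
    qed
    moreover have "quad I m v v = - c * (s\<^sup>2 * P - 2 * s * t * d + t\<^sup>2 * R)"
      unfolding v_def quad_lin_left quad_lin_right
      by (simp add: a_def[symmetric] b_def[symmetric] c_def[symmetric] qc[of w x] qc[of w y] qc[of y x]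
          P_def R_def d_def power2_eq_square algebra_simps)
    ultimately show ?thesis using c by (simp add: zero_le_mult_iff)
  qed
  have P0: "P \<ge> 0" using le[of 1 0] by simp
  have "d\<^sup>2 \<le> P * R"
  proof (cases "P = 0")
    case True
    have "d = 0"
    proof (rule ccontr)
      assume "d \<noteq> 0"
      \<comment> \<open>With \<open>P = 0\<close> and \<open>t = 1\<close> this \<open>s\<close>
        makes the expression in \<open>le\<close> equal to -1.\<close>
      with le[of "(R + 1) / (2 * d)" 1] True show False by simp
    qed
    then show ?thesis using True by simp
  next
    case False
    have "0 \<le> P * (P * R - d\<^sup>2)"
      using le[of d P] by (simp add: power2_eq_square algebra_simps)
    then show ?thesis using False P0 by (simp add: zero_le_mult_iff)
  qed
  then show ?thesis by (simp add: d_def P_def R_def a_def b_def c_def)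
qed

text \<open>On mean-zero functions the Laplacian \<open>Q = 1 - N\<close> of the weighted graph is invertible.  The
  hypothesis says \<open>\<langle>y, Q y\<rangle> \<le> \<langle>Q y, Q y\<rangle>\<close>; for \<open>x = Q y\<close> the Cauchy--Schwarz
  inequality of the Laplacian form gives \<open>\<langle>x, x\<rangle>\<^sup>2 \<le> \<langle>x, Q x\<rangle> \<langle>y, Q y\<rangle>\<close>, hence
  \<open>\<langle>x, x\<rangle> \<le> \<langle>x, Q x\<rangle>\<close>.\<close>

lemma reversible_chain_nonpos:
  fixes w :: "'i \<Rightarrow> 'i \<Rightarrow> real" and d :: "'i \<Rightarrow> real"
  assumes fin: "finite I"
    and sym: "\<And>i j. i \<in> I \<Longrightarrow> j \<in> I \<Longrightarrow> w i j = w j i"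
    and nonneg: "\<And>i j. i \<in> I \<Longrightarrow> j \<in> I \<Longrightarrow> w i j \<ge> 0"
    and d_def: "\<And>i. i \<in> I \<Longrightarrow> d i = (\<Sum>j\<in>I. w i j)"
    and d_pos: "\<And>i. i \<in> I \<Longrightarrow> d i > 0"
    and conn: "\<And>i j. i \<in> I \<Longrightarrow> j \<in> I \<Longrightarrow> i \<noteq> j \<Longrightarrow> w i j > 0 \<or> (\<exists>k\<in>I. w i k > 0 \<and> w k j > 0)"
    and spec: "\<And>x. (\<Sum>i\<in>I. \<Sum>j\<in>I. w i j * x i * x j) \<le> (\<Sum>i\<in>I. (\<Sum>j\<in>I. w i j * x j)\<^sup>2 / d i)"
    and mean0: "(\<Sum>i\<in>I. d i * x i) = 0"
  shows "(\<Sum>i\<in>I. \<Sum>j\<in>I. w i j * x i * x j) \<le> 0"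
proof -
  \<comment> \<open>The Laplacian form of the graph with edge weights \<open>w\<close>;
    \<open>E_half\<close> writes it through differences, which makes it positive
    semidefinite.\<close>
  define E where "E x y = (\<Sum>i\<in>I. d i * x i * y i) - (\<Sum>i\<in>I. \<Sum>j\<in>I. w i j * x i * y j)"
    for x y :: "'i \<Rightarrow> real"
  have E_half: "2 * E x y = (\<Sum>i\<in>I. \<Sum>j\<in>I. w i j * (x i - x j) * (y i - y j))" for x y
  proof -
    have "(\<Sum>i\<in>I. \<Sum>j\<in>I. w i j * (x i - x j) * (y i - y j))
      = (\<Sum>i\<in>I. \<Sum>j\<in>I. w i j * x i * y i) + (\<Sum>i\<in>I. \<Sum>j\<in>I. w i j * x j * y j)
       - (\<Sum>i\<in>I. \<Sum>j\<in>I. w i j * x i * y j) - (\<Sum>i\<in>I. \<Sum>j\<in>I. w i j * x j * y i)"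
      by (simp add: sum.distrib[symmetric] sum_subtractf[symmetric] algebra_simps)
    moreover have "(\<Sum>i\<in>I. \<Sum>j\<in>I. w i j * x i * y i) = (\<Sum>i\<in>I. d i * x i * y i)"
      by (intro sum.cong refl) (simp add: d_def sum_distrib_right)
    moreover have "(\<Sum>i\<in>I. \<Sum>j\<in>I. w i j * x j * y j) = (\<Sum>i\<in>I. d i * x i * y i)"
      by (subst sum.swap, intro sum.cong refl) (simp add: d_def sum_distrib_right sym)
    moreover have "(\<Sum>i\<in>I. \<Sum>j\<in>I. w i j * x j * y i) = (\<Sum>i\<in>I. \<Sum>j\<in>I. w i j * x i * y j)"
      by (subst sum.swap, intro sum.cong refl) (simp add: sym)
    ultimately show ?thesis by (simp add: E_def)
  qed
  have E_nonneg: "E x x \<ge> 0" for x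
  proof -
    have "2 * E x x \<ge> 0"
      unfolding E_half by (intro sum_nonneg) (simp add: nonneg mult.assoc)
    then show ?thesis by simp
  qed
  have E_sym: "E x y = E y x" for x y
    using E_half[of x y] E_half[of y x] by (simp add: mult.commute mult.left_commute)
  have E_lin: "E (\<lambda>i. s * x i + t * y i) (\<lambda>i. s * x i + t * y i)
      = s\<^sup>2 * E x x + 2 * s * t * E x y + t\<^sup>2 * E y y" for s t x y
  proof -
    have "2 * E (\<lambda>i. s * x i + t * y i) (\<lambda>i. s * x i + t * y i)
      = s\<^sup>2 * (2 * E x x) + 2 * s * t * (2 * E x y) + t\<^sup>2 * (2 * E y y)"
      unfolding E_half by (simp add: sum_distrib_left sum.distrib[symmetric] power2_eq_square algebra_simps)
    then show ?thesis by simp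
  qed
  have CS: "(E x y)\<^sup>2 \<le> E x x * E y y" for x y
  proof (cases "E y y = 0")
    case True
    have "E x y = 0"
    proof (rule ccontr)
      assume "E x y \<noteq> 0"
      then show False
        using E_nonneg[of "\<lambda>i. 1 * x i + (- (E x x + 1) / (2 * E x y)) * y i"] E_lin[of 1 x "- (E x x + 1) / (2 * E x y)" y] True
        by (simp add: field_simps)
    qed
    then show ?thesis by (simp add: True)
  next
    case False
    then have p: "E y y > 0" using E_nonneg[of y] by simp
    have "0 \<le> E y y * (E x x * E y y - (E x y)\<^sup>2)"
      using E_nonneg[of "\<lambda>i. E y y * x i + (- E x y) * y i"] E_lin[of "E y y" x "- E x y" y]
      by (simp add: power2_eq_square algebra_simps)
    then show ?thesis using p by (simp add: zero_le_mult_iff)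
  qed
  \<comment> \<open>Any two vertices are joined by a path of at most two edges, so only constants
    are in the kernel of \<open>E\<close>.\<close>
  have E_zero: "x i = x j" if "E x x = 0" "i \<in> I" "j \<in> I" for x i j
  proof -
    have "(\<Sum>i\<in>I. \<Sum>j\<in>I. w i j * (x i - x j) * (x i - x j)) = 0"
      using that E_half[of x x] by simp
    then have *: "w a b * (x a - x b) * (x a - x b) = 0" if "a \<in> I" "b \<in> I" for a b
      using that fin nonneg
      by (simp add: sum_nonneg_eq_0_iff sum_nonneg mult.assoc)
    then have eq: "x a = x b" if "w a b > 0" "a \<in> I" "b \<in> I" for a b
      using that *[of a b] by simp
    show ?thesis using conn[of i j] that eq by metis
  qed
  \<comment> \<open>The Laplacian kills the constants. The rank-one term \<open>d i * d j\<close>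
    removes this kernel and has no effect on mean-zero functions.\<close>
  define L where "L i j = (if i = j then d i else 0) - w i j + d i * d j" for i j
  have L_sum: "(\<Sum>j\<in>I. L i j * y j) = d i * y i - (\<Sum>j\<in>I. w i j * y j) + d i * (\<Sum>j\<in>I. d j * y j)"
    if "i \<in> I" for i and y :: "'i \<Rightarrow> real"
  proof -
    have "(\<Sum>j\<in>I. L i j * y j) = (\<Sum>j\<in>I. (if i = j then d i * y i else 0) - w i j * y j + d i * (d j * y j))"
      by (intro sum.cong refl) (simp add: L_def algebra_simps)
    then show ?thesis using that fin by (simp add: sum.distrib sum_subtractf sum_distrib_left)
  qed
  have pair: "(\<Sum>i\<in>I. x i * (\<Sum>j\<in>I. L i j * y j)) = E x y + (\<Sum>i\<in>I. d i * x i) * (\<Sum>i\<in>I. d i * y i)" for x y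
  proof -
    have "(\<Sum>i\<in>I. x i * (\<Sum>j\<in>I. L i j * y j))
      = (\<Sum>i\<in>I. d i * x i * y i - (\<Sum>j\<in>I. w i j * x i * y j) + d i * x i * (\<Sum>j\<in>I. d j * y j))"
    proof (intro sum.cong refl)
      fix i assume i: "i \<in> I"
      show "x i * (\<Sum>j\<in>I. L i j * y j)
        = d i * x i * y i - (\<Sum>j\<in>I. w i j * x i * y j) + d i * x i * (\<Sum>j\<in>I. d j * y j)"
        unfolding L_sum[OF i] by (simp add: distrib_left right_diff_distrib sum_distrib_left mult_ac)
    qed
    then show ?thesis by (simp add: E_def sum.distrib sum_subtractf sum_distrib_right)
  qed
  obtain y where y: "\<And>i. i \<in> I \<Longrightarrow> (\<Sum>j\<in>I. L i j * y j) = d i * x i"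
  proof (rule injective_system_solvable[OF fin, of L "\<lambda>i. d i * x i"])
    fix y i assume 0: "\<And>i. i \<in> I \<Longrightarrow> (\<Sum>j\<in>I. L i j * y j) = 0" and i: "i \<in> I"
    have "E y y + (\<Sum>i\<in>I. d i * y i)\<^sup>2 = 0" using pair[of y y] 0 by (simp add: power2_eq_square)
    then have z: "E y y = 0" "(\<Sum>i\<in>I. d i * y i) = 0"
      using E_nonneg[of y] zero_le_power2[of "\<Sum>i\<in>I. d i * y i"] by (linarith, simp add: add_nonneg_eq_0_iff)
    have "(\<Sum>j\<in>I. d j * y j) = (\<Sum>j\<in>I. d j) * y i"
      using E_zero[OF z(1) _ i] by (simp add: sum_distrib_right)
    moreover have "(\<Sum>j\<in>I. d j) > 0" using d_pos i fin by (intro sum_pos) auto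
    ultimately show "y i = 0" using z by simp
  qed blast
  \<comment> \<open>Pairing the equation with the constant 1 shows that \<open>y\<close> has mean
    zero, so the rank-one term drops out of it.\<close>
  have total: "(\<Sum>i\<in>I. d i * y i) = 0"
  proof (cases "I = {}")
    case False
    have "E (\<lambda>_. 1) y = 0"
    proof -
      have "2 * E (\<lambda>_. 1) y = 0" unfolding E_half by simp
      then show ?thesis by simp
    qed
    then have "(\<Sum>i\<in>I. d i) * (\<Sum>i\<in>I. d i * y i) = 0"
      using pair[of "\<lambda>_. 1" y] y mean0 by simp
    moreover have "(\<Sum>j\<in>I. d j) > 0" using d_pos False fin by (intro sum_pos) auto
    ultimately show ?thesis by simp
  qed simp
  define X where "X = (\<Sum>i\<in>I. d i * x i * x i)"
  have Ly: "d i * x i = d i * y i - (\<Sum>j\<in>I. w i j * y j)" if "i \<in> I" for i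
    using y[OF that] L_sum[OF that, of y] total by simp
  have Exy: "E x y = X"
    using pair[of x y] y mean0 by (simp add: X_def mult_ac)
  have "E y y \<le> X"
  proof -
    \<comment> \<open>The equation says that row \<open>i\<close> of \<open>w\<close> applied to
      \<open>y\<close> is \<open>d i * (y i - x i)\<close>; inserting this into \<open>spec\<close>
      leaves \<open>E y y \<le> X\<close>.\<close>
    have "(\<Sum>j\<in>I. w i j * y j)\<^sup>2 / d i = d i * y i * y i - 2 * (d i * x i * y i) + d i * x i * x i" if "i \<in> I" for i
    proof -
      have *: "(\<Sum>j\<in>I. w i j * y j) = d i * (y i - x i)" using Ly[OF that] by (simp add: algebra_simps)
      show ?thesis unfolding * using d_pos[OF that] by (simp add: power2_eq_square field_simps)
    qed
    then have "(\<Sum>i\<in>I. (\<Sum>j\<in>I. w i j * y j)\<^sup>2 / d i)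
        = (\<Sum>i\<in>I. d i * y i * y i) - 2 * (\<Sum>i\<in>I. d i * x i * y i) + X"
      by (simp add: X_def sum.distrib sum_subtractf sum_distrib_left)
    moreover have "(\<Sum>i\<in>I. d i * x i * y i) = E y y"
    proof -
      have "(\<Sum>i\<in>I. y i * (\<Sum>j\<in>I. L i j * y j)) = (\<Sum>i\<in>I. d i * x i * y i)"
        by (intro sum.cong refl) (simp add: y)
      then show ?thesis using pair[of y y] total by simp
    qed
    ultimately show ?thesis using spec[of y] by (simp add: E_def)
  qed
  moreover have "X \<ge> 0" unfolding X_def using d_pos by (intro sum_nonneg) (simp add: less_imp_le mult.assoc)
  ultimately have "X * X \<le> E x x * X"
    using CS[of x y] Exy E_nonneg[of x] mult_left_mono[of "E y y" X "E x x"]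
    by (simp add: power2_eq_square)
  then have "X \<le> E x x" using \<open>X \<ge> 0\<close> E_nonneg[of x] by (cases "X = 0") auto
  then show ?thesis by (simp add: E_def X_def)
qed

text \<open>Writing \<open>v i = h i * x i\<close> turns \<open>m\<close> into the edge weights
  \<open>m i j * h i * h j\<close>. Orthogonality to \<open>h\<close> becomes mean zero, and
  \<open>spec\<close> becomes the hypothesis of \<open>reversible_chain_nonpos\<close>.\<close>

lemma hyperbolic_of_bochner:
  fixes m :: "'i \<Rightarrow> 'i \<Rightarrow> real" and h :: "'i \<Rightarrow> real"
  assumes fin: "finite I"
    and sym: "\<And>i j. i \<in> I \<Longrightarrow> j \<in> I \<Longrightarrow> m i j = m j i"
    and nonneg: "\<And>i j. i \<in> I \<Longrightarrow> j \<in> I \<Longrightarrow> m i j \<ge> 0"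
    and h_pos: "\<And>i. i \<in> I \<Longrightarrow> h i > 0"
    and D_pos: "\<And>i. i \<in> I \<Longrightarrow> (\<Sum>j\<in>I. m i j * h j) > 0"
    and conn: "\<And>i j. i \<in> I \<Longrightarrow> j \<in> I \<Longrightarrow> i \<noteq> j \<Longrightarrow> m i j > 0 \<or> (\<exists>k\<in>I. m i k > 0 \<and> m k j > 0)"
    and spec: "\<And>v. quad I m v v \<le> (\<Sum>i\<in>I. h i * (\<Sum>j\<in>I. m i j * v j)\<^sup>2 / (\<Sum>j\<in>I. m i j * h j))"
  shows "hyperbolic (quad I m)"
proof (rule hyperbolicI_orthogonal[OF sym, where h = h])
  fix v assume orth: "quad I m v h = 0"
  define w where "w i j = m i j * h i * h j" for i j
  define d where "d i = (\<Sum>j\<in>I. w i j)" for i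
  have d: "d i = h i * (\<Sum>j\<in>I. m i j * h j)" for i
    by (simp add: d_def w_def sum_distrib_left mult_ac)
  have rew: "(\<Sum>i\<in>I. \<Sum>j\<in>I. w i j * x i * x j) = quad I m (\<lambda>i. h i * x i) (\<lambda>i. h i * x i)" for x
    by (simp add: quad_def w_def mult_ac)
  have "(\<Sum>i\<in>I. \<Sum>j\<in>I. w i j * (v i / h i) * (v j / h j)) \<le> 0"
  proof (rule reversible_chain_nonpos[OF fin, of w d])
    show "w i j = w j i" if "i \<in> I" "j \<in> I" for i j using sym[OF that] by (simp add: w_def)
    show "w i j \<ge> 0" if "i \<in> I" "j \<in> I" for i j
      using nonneg[OF that] h_pos that by (simp add: w_def less_imp_le)
    show "d i = (\<Sum>j\<in>I. w i j)" for i by (simp add: d_def)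
    show "d i > 0" if "i \<in> I" for i using d h_pos D_pos that by simp
    show "w i j > 0 \<or> (\<exists>k\<in>I. w i k > 0 \<and> w k j > 0)" if "i \<in> I" "j \<in> I" "i \<noteq> j" for i j
      using conn[OF that] h_pos that unfolding w_def by (meson mult_pos_pos)
    show "(\<Sum>i\<in>I. d i * (v i / h i)) = 0"
    proof -
      have "(\<Sum>i\<in>I. d i * (v i / h i)) = quad I m v h"
        unfolding quad_def
      proof (intro sum.cong refl)
        fix i assume "i \<in> I"
        then have "h i \<noteq> 0" using h_pos[of i] by simp
        then show "d i * (v i / h i) = (\<Sum>j\<in>I. m i j * v i * h j)"
          by (simp add: d sum_distrib_left mult_ac)
      qed
      then show ?thesis using orth by simp
    qed
    show "(\<Sum>i\<in>I. \<Sum>j\<in>I. w i j * x i * x j) \<le> (\<Sum>i\<in>I. (\<Sum>j\<in>I. w i j * x j)\<^sup>2 / d i)" for x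
    proof -
      have "(\<Sum>j\<in>I. w i j * x j)\<^sup>2 / d i
        = h i * (\<Sum>j\<in>I. m i j * (h j * x j))\<^sup>2 / (\<Sum>j\<in>I. m i j * h j)" if "i \<in> I" for i
      proof -
        have "(\<Sum>j\<in>I. w i j * x j) = h i * (\<Sum>j\<in>I. m i j * (h j * x j))"
          by (simp add: w_def sum_distrib_left mult_ac)
        then show ?thesis using h_pos[OF that] by (simp add: d power2_eq_square)
      qed
      then show ?thesis unfolding rew using spec[of "\<lambda>i. h i * x i"] by simp
    qed
  qed
  moreover have "quad I m (\<lambda>i. h i * (v i / h i)) (\<lambda>i. h i * (v i / h i)) = quad I m v v"
    unfolding quad_def using h_pos by (intro sum.cong refl) (auto simp: less_imp_neq[symmetric])
  ultimately show "quad I m v v \<le> 0" by (simp only: rew)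
qed

section \<open>Removing elements at the ends of an order\<close>

text \<open>\<open>z\<close> is the element whose position is recorded; it is never removed. The
  order laws are required on the whole type, so that they hold in every subset without side
  conditions.\<close>

locale marked_order =
  fixes lt :: "'a \<Rightarrow> 'a \<Rightarrow> bool" and z :: 'a
  assumes lt_irrefl: "\<not> lt u u"
    and lt_trans: "lt u v \<Longrightarrow> lt v w \<Longrightarrow> lt u w"
begin

text \<open>\<open>(u, True)\<close> is the removal of the maximal element \<open>u\<close> from the top, \<open>(u, False)\<close> the removal
  of the minimal element \<open>u\<close> from the bottom.\<close>

definition ends :: "'a set \<Rightarrow> ('a \<times> bool) set" where
  "ends S = {(u, s). u \<in> S \<and> u \<noteq> z \<and> (\<forall>y\<in>S. \<not> (if s then lt u y else lt y u))}"

definition wt :: "real \<Rightarrow> bool \<Rightarrow> 'a \<times> bool \<Rightarrow> real" where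
  "wt e b i = (if b = snd i then 1 else e)"

text \<open>A list \<open>bs\<close> prescribes the side of each removal.  For \<open>e = 0\<close> this yields counts of linear
  extensions; a removal on the wrong side has weight \<open>e\<close>, and \<open>e > 0\<close> makes all counts positive.\<close>

primrec vol :: "real \<Rightarrow> bool list \<Rightarrow> 'a set \<Rightarrow> real" where
  "vol e [] = (\<lambda>S. 1)"
| "vol e (b # bs) = (\<lambda>S. \<Sum>i\<in>ends S. wt e b i * vol e bs (S - {fst i}))"

text \<open>An end of \<open>S - {fst i}\<close> that is not yet an end of \<open>S\<close> was blocked only by \<open>i\<close> and inherits its
  coordinate.\<close>

definition lift :: "'a set \<Rightarrow> 'a \<times> bool \<Rightarrow> ('a \<times> bool \<Rightarrow> real) \<Rightarrow> 'a \<times> bool \<Rightarrow> real" where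
  "lift S i v j = (if j \<in> ends S then v j else v i)"

text \<open>Row \<open>i\<close> of the matrix of \<open>form\<close>, applied to \<open>v\<close>:
  after the removal of \<open>i\<close> the vector is transported to the ends of the smaller
  set.\<close>

definition action :: "real \<Rightarrow> bool list \<Rightarrow> 'a set \<Rightarrow> ('a \<times> bool \<Rightarrow> real) \<Rightarrow> 'a \<times> bool \<Rightarrow> real" where
  "action e bs S v i = (\<Sum>j\<in>ends (S - {fst i}). lift S i v j * vol e bs (S - {fst i} - {fst j}))"

definition form :: "real \<Rightarrow> bool list \<Rightarrow> 'a set \<Rightarrow> ('a \<times> bool \<Rightarrow> real) \<Rightarrow> ('a \<times> bool \<Rightarrow> real) \<Rightarrow> real" where
  "form e bs S x y = (\<Sum>i\<in>ends S. x i * action e bs S y i)"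

text \<open>The matrix of \<open>form\<close>. The diagonal collects the ends that appear only after
  \<open>i\<close> is removed, because they inherit the coordinate \<open>v i\<close>.\<close>

definition entry :: "real \<Rightarrow> bool list \<Rightarrow> 'a set \<Rightarrow> 'a \<times> bool \<Rightarrow> 'a \<times> bool \<Rightarrow> real" where
  "entry e bs S i j = (if fst i \<noteq> fst j then vol e bs (S - {fst i} - {fst j}) else 0)
    + (if i = j then \<Sum>k\<in>ends (S - {fst i}) - ends S. vol e bs (S - {fst i} - {fst k}) else 0)"

lemma finite_ends [simp]: "finite S \<Longrightarrow> finite (ends S)"
  by (rule finite_subset[of _ "S \<times> UNIV"]) (auto simp: ends_def)

lemma endsD: "i \<in> ends S \<Longrightarrow> fst i \<in> S \<and> fst i \<noteq> z"
  by (auto simp: ends_def)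

lemma ends_Diff: "j \<in> ends S \<Longrightarrow> fst j \<noteq> u \<Longrightarrow> j \<in> ends (S - {u})"
  by (auto simp: ends_def)

text \<open>Only \<open>i\<close> blocked \<open>j\<close>. Were \<open>i\<close> an end on the
  opposite side, then \<open>j\<close> itself would prevent \<open>i\<close> from being
  extremal.\<close>

lemma ends_new:
  assumes "i \<in> ends S" "j \<in> ends (S - {fst i})" "j \<notin> ends S"
  shows "snd j = snd i" "if snd j then lt (fst j) (fst i) else lt (fst i) (fst j)"
  using assms by (auto simp: ends_def split: if_splits prod.splits)

lemma ends_split:
  assumes "i \<in> ends S"
  shows "ends (S - {fst i}) = {j \<in> ends S. fst j \<noteq> fst i} \<union> (ends (S - {fst i}) - ends S)"
  using ends_Diff endsD by blast

lemma ex_maximal: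
  assumes "finite A" "A \<noteq> {}"
  obtains u where "u \<in> A" "\<And>y. y \<in> A \<Longrightarrow> \<not> lt u y"
proof -
  have "asymp_on A lt" "transp_on A lt"
    using lt_irrefl lt_trans by (blast intro: asymp_onI, blast intro: transp_onI)
  then show ?thesis
    using Finite_Set.bex_max_element[OF assms(1) _ _ assms(2)] lt_irrefl that by metis
qed

lemma ex_minimal:
  assumes "finite A" "A \<noteq> {}"
  obtains u where "u \<in> A" "\<And>y. y \<in> A \<Longrightarrow> \<not> lt y u"
proof -
  have "asymp_on A (\<lambda>x y. lt y x)" "transp_on A (\<lambda>x y. lt y x)"
    using lt_irrefl lt_trans by (blast intro: asymp_onI, blast intro: transp_onI)
  then show ?thesis
    using Finite_Set.bex_max_element[OF assms(1) _ _ assms(2)] lt_irrefl that by metis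
qed

text \<open>An extremal element of \<open>S - {z}\<close> can be blocked only by \<open>z\<close>. A
  maximal \<open>u\<close> below \<open>z\<close> and a minimal \<open>v\<close> above
  \<open>z\<close> cannot both occur, since then \<open>u\<close> would lie below
  \<open>v\<close>.\<close>

lemma ends_nonempty:
  assumes "finite S" "z \<in> S" "card S \<ge> 2"
  shows "ends S \<noteq> {}"
proof -
  have ne: "S - {z} \<noteq> {}" "finite (S - {z})" using assms by (auto simp: subset_singleton_iff)
  obtain u where u: "u \<in> S - {z}" "\<And>y. y \<in> S - {z} \<Longrightarrow> \<not> lt u y" using ex_maximal[OF ne(2,1)] by metis
  obtain v where v: "v \<in> S - {z}" "\<And>y. y \<in> S - {z} \<Longrightarrow> \<not> lt y v" using ex_minimal[OF ne(2,1)] by metis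
  show ?thesis
  proof (cases "lt u z")
    case True
    then have "\<not> lt z v" using lt_trans u v by blast
    then have "(v, False) \<in> ends S" using v by (auto simp: ends_def)
    then show ?thesis by blast
  next
    case False
    then have "(u, True) \<in> ends S" using u by (auto simp: ends_def)
    then show ?thesis by blast
  qed
qed

lemma vol_nonneg: "e \<ge> 0 \<Longrightarrow> vol e bs S \<ge> 0"
  by (induction bs arbitrary: S) (auto simp: wt_def intro!: sum_nonneg mult_nonneg_nonneg)

lemma vol_pos:
  assumes "e > 0" "finite S" "z \<in> S" "card S = length bs + 1"
  shows "vol e bs S > 0"
  using assms(2-)
proof (induction bs arbitrary: S)
  case (Cons b bs)
  have "vol e bs (S - {fst i}) > 0" if "i \<in> ends S" for i
    using Cons endsD[OF that] by (intro Cons.IH) auto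
  then show ?case
    using Cons.prems ends_nonempty[of S] \<open>e > 0\<close> by (auto intro!: sum_pos simp: wt_def)
qed simp

lemma action_entry:
  assumes "finite S" "i \<in> ends S"
  shows "action e bs S v i = (\<Sum>j\<in>ends S. entry e bs S i j * v j)"
proof -
  let ?f = "\<lambda>j. lift S i v j * vol e bs (S - {fst i} - {fst j})"
  have "action e bs S v i = sum ?f {j \<in> ends S. fst j \<noteq> fst i} + sum ?f (ends (S - {fst i}) - ends S)"
    unfolding action_def
    by (subst ends_split[OF assms(2)], rule sum.union_disjoint) (use assms in auto)
  also have "sum ?f {j \<in> ends S. fst j \<noteq> fst i}
      = (\<Sum>j\<in>ends S. (if fst i \<noteq> fst j then vol e bs (S - {fst i} - {fst j}) else 0) * v j)"
    using assms by (subst sum.inter_filter) (auto intro!: sum.cong simp: lift_def)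
  also have "sum ?f (ends (S - {fst i}) - ends S)
      = (\<Sum>k\<in>ends (S - {fst i}) - ends S. vol e bs (S - {fst i} - {fst k})) * v i"
    by (subst mult.commute) (simp add: lift_def sum_distrib_left)
  also have "\<dots> = (\<Sum>j\<in>ends S. (if i = j then \<Sum>k\<in>ends (S - {fst i}) - ends S. vol e bs (S - {fst i} - {fst k}) else 0) * v j)"
    using assms by (simp add: if_distrib[of "\<lambda>c. c * _"] cong: if_cong)
  finally show ?thesis by (simp only: entry_def distrib_right sum.distrib)
qed

lemma form_quad:
  assumes "finite S"
  shows "form e bs S = quad (ends S) (entry e bs S)"
  unfolding form_def quad_def
  by (intro ext sum.cong refl) (simp add: action_entry[OF assms] sum_distrib_left mult_ac)

lemma entry_sym: "entry e bs S i j = entry e bs S j i"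
  by (auto simp: entry_def Diff_insert2[symmetric] insert_commute)

lemma entry_nonneg: "e \<ge> 0 \<Longrightarrow> entry e bs S i j \<ge> 0"
  by (auto simp: entry_def intro!: add_nonneg_nonneg sum_nonneg vol_nonneg)

lemma form_sym: "finite S \<Longrightarrow> form e bs S x y = form e bs S y x"
  by (simp add: form_quad quad_commute entry_sym)

lemma form_cong:
  assumes "finite S" "\<And>i. i \<in> ends S \<Longrightarrow> x i = x' i" "\<And>i. i \<in> ends S \<Longrightarrow> y i = y' i"
  shows "form e bs S x y = form e bs S x' y'"
  using assms by (simp add: form_quad quad_def)

text \<open>Weights depend only on the side, and a new end lies on the side of the end that blocked
  it.\<close>

lemma lift_wt: "i \<in> ends S \<Longrightarrow> j \<in> ends (S - {fst i}) \<Longrightarrow> lift S i (wt e b) j = wt e b j"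
  using ends_new(1)[of i S j] by (auto simp: lift_def wt_def)

lemma action_wt: "i \<in> ends S \<Longrightarrow> action e bs S (wt e b) i = vol e (b # bs) (S - {fst i})"
  by (simp add: action_def lift_wt)

text \<open>The recursion behind the induction: each row of the form for \<open>b # bs\<close> is a
  form for \<open>bs\<close> on a set with one element less, paired with a weight vector.\<close>

lemma action_Cons:
  "i \<in> ends S \<Longrightarrow> action e (b # bs) S v i = form e bs (S - {fst i}) (lift S i v) (wt e b)"
  unfolding action_def[of e "b # bs"] form_def by (intro sum.cong refl) (simp add: action_wt)

text \<open>Both sides sum over removals of three elements.  Exchanging the first two changes the value
  transported to an end created by both removals together, and the resulting error terms combine to
  squares \<open>(v j - v i)\<^sup>2\<close>.\<close>

lemma form_pullback:
  assumes fin: "finite S" and e: "e \<ge> 0"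
  shows "form e (b # bs) S v v
    \<le> (\<Sum>i\<in>ends S. wt e b i * form e bs (S - {fst i}) (lift S i v) (lift S i v))"
proof -
  define h where "h = wt e b"
  define r where "r i j = action e bs (S - {fst i}) (lift S i v) j" for i j :: "'a \<times> bool"
  define N where "N i = ends (S - {fst i}) - ends S" for i :: "'a \<times> bool"
  \<comment> \<open>The total weight of the ends that appear only after both \<open>i\<close> and
    \<open>j\<close> have been removed.\<close>
  define U where "U i j = (\<Sum>k\<in>ends (S - {fst i} - {fst j}) - ends (S - {fst i}) - ends (S - {fst j}).
    vol e bs (S - {fst i} - {fst j} - {fst k}))" for i j :: "'a \<times> bool"
  have comm: "S - {a} - {c} = S - {c} - {a}" for a c by blast
  have Usym: "U i j = U j i" for i j
    unfolding U_def comm[of "fst i" "fst j"] by (intro sum.cong) auto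
  have U0: "U i j \<ge> 0" for i j
    unfolding U_def using e by (intro sum_nonneg vol_nonneg)
  \<comment> \<open>Such an end shares its side with \<open>j\<close> and with \<open>i\<close>, so
    the two weights agree.\<close>
  have Usign: "h i = h j" if ij: "i \<in> ends S" "j \<in> ends S" "fst i \<noteq> fst j" "U i j \<noteq> 0" for i j
  proof -
    obtain k where k: "k \<in> ends (S - {fst i} - {fst j})" "k \<notin> ends (S - {fst i})" "k \<notin> ends (S - {fst j})"
      using ij(4) unfolding U_def by (metis (no_types, lifting) DiffE ex_in_conv sum.empty)
    have "snd k = snd j" using k ij by (intro ends_new(1)[of j "S - {fst i}" k]) (auto intro: ends_Diff)
    moreover have "snd k = snd i"
      using k ij comm by (intro ends_new(1)[of i "S - {fst j}" k]) (auto intro: ends_Diff)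
    ultimately show ?thesis by (simp add: h_def wt_def)
  qed
  \<comment> \<open>Both orders of removal transport the same value to an end visible after one of
    the removals. Otherwise the last removed element passes on its value, which gives
    \<open>v j\<close> against \<open>v i\<close>.\<close>
  have rdiff: "r i j - r j i = (v j - v i) * U i j"
    if ij: "i \<in> ends S" "j \<in> ends S" "fst i \<noteq> fst j" for i j
  proof -
    let ?E = "ends (S - {fst i} - {fst j})"
    have "r i j - r j i = (\<Sum>k\<in>?E. (lift (S - {fst i}) j (lift S i v) k - lift (S - {fst j}) i (lift S j v) k)
        * vol e bs (S - {fst i} - {fst j} - {fst k}))"
      unfolding r_def action_def comm[of "fst j" "fst i"] by (simp add: sum_subtractf[symmetric] left_diff_distrib)
    also have "\<dots> = (\<Sum>k\<in>?E. if k \<in> ends (S - {fst i}) \<or> k \<in> ends (S - {fst j}) then 0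
        else (v j - v i) * vol e bs (S - {fst i} - {fst j} - {fst k}))"
    proof (intro sum.cong refl)
      fix k assume k: "k \<in> ?E"
      then have kS: "fst k \<in> S" "fst k \<noteq> fst i" "fst k \<noteq> fst j" using endsD[OF k] by auto
      have *: "lift (S - {fst i}) j (lift S i v) k = lift (S - {fst j}) i (lift S j v) k"
        if "k \<in> ends (S - {fst i})" "i \<in> ends S" "j \<in> ends S" "fst i \<noteq> fst j" "fst k \<noteq> fst j" for i j
      proof (cases "k \<in> ends S")
        case True
        then have "k \<in> ends (S - {fst j})" using that by (intro ends_Diff) auto
        then show ?thesis using True that by (simp add: lift_def)
      next
        case False
        have "k \<notin> ends (S - {fst j})"
          using ends_new(2)[of i S k] that False endsD[of i S]
          by (auto simp: ends_def split: if_splits)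
        then show ?thesis using False that by (simp add: lift_def)
      qed
      have "lift (S - {fst i}) j (lift S i v) k - lift (S - {fst j}) i (lift S j v) k
        = (if k \<in> ends (S - {fst i}) \<or> k \<in> ends (S - {fst j}) then 0 else v j - v i)"
        using *[of i j] *[of j i] ij kS by (auto simp: lift_def)
      then show "(lift (S - {fst i}) j (lift S i v) k - lift (S - {fst j}) i (lift S j v) k)
          * vol e bs (S - {fst i} - {fst j} - {fst k})
        = (if k \<in> ends (S - {fst i}) \<or> k \<in> ends (S - {fst j}) then 0
          else (v j - v i) * vol e bs (S - {fst i} - {fst j} - {fst k}))"
        by simp
    qed
    also have "\<dots> = (\<Sum>k\<in>?E - ends (S - {fst i}) - ends (S - {fst j}).
        (v j - v i) * vol e bs (S - {fst i} - {fst j} - {fst k}))"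
      using fin by (intro sum.mono_neutral_cong_right) auto
    finally show ?thesis by (simp add: U_def sum_distrib_left)
  qed
  let ?P = "{p \<in> ends S \<times> ends S. fst (fst p) \<noteq> fst (snd p)}"
  have finP: "finite ?P" using fin by simp
  have split: "(\<Sum>i\<in>ends S. \<Sum>j\<in>ends (S - {fst i}). f i j)
      = (\<Sum>(i, j)\<in>?P. f i j) + (\<Sum>i\<in>ends S. \<Sum>j\<in>N i. f i j)" for f :: "_ \<Rightarrow> _ \<Rightarrow> real"
  proof -
    have "(\<Sum>j\<in>ends (S - {fst i}). f i j) = (\<Sum>j\<in>{j \<in> ends S. fst i \<noteq> fst j}. f i j) + (\<Sum>j\<in>N i. f i j)"
      if "i \<in> ends S" for i
    proof -
      have "{j \<in> ends S. fst j \<noteq> fst i} = {j \<in> ends S. fst i \<noteq> fst j}" by auto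
      then show ?thesis using fin unfolding N_def
        by (subst ends_split[OF that]) (subst sum.union_disjoint, auto)
    qed
    moreover have "(\<Sum>i\<in>ends S. \<Sum>j\<in>{j \<in> ends S. fst i \<noteq> fst j}. f i j) = (\<Sum>(i, j)\<in>?P. f i j)"
      using fin by (subst sum.Sigma) (auto intro!: sum.cong)
    ultimately show ?thesis by (simp add: sum.distrib)
  qed
  have left: "form e (b # bs) S v v = (\<Sum>(i, j)\<in>?P. v i * h j * r i j) + (\<Sum>i\<in>ends S. \<Sum>j\<in>N i. v i * h j * r i j)"
  proof -
    have "form e (b # bs) S v v = (\<Sum>i\<in>ends S. v i * form e bs (S - {fst i}) h (lift S i v))"
      unfolding form_def[of e "b # bs"] using fin
      by (intro sum.cong refl) (simp add: action_Cons h_def form_sym)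
    then show ?thesis
      by (simp add: form_def r_def sum_distrib_left mult.assoc split[symmetric])
  qed
  have right: "(\<Sum>i\<in>ends S. h i * form e bs (S - {fst i}) (lift S i v) (lift S i v))
    = (\<Sum>(i, j)\<in>?P. h i * lift S i v j * r i j) + (\<Sum>i\<in>ends S. \<Sum>j\<in>N i. h i * lift S i v j * r i j)"
    by (simp add: form_def r_def sum_distrib_left mult.assoc split[symmetric])
  \<comment> \<open>At a new end \<open>lift\<close> gives \<open>v i\<close>, and
    \<open>h i = h j\<close>; these terms cancel exactly.\<close>
  have new: "(\<Sum>i\<in>ends S. \<Sum>j\<in>N i. h i * lift S i v j * r i j) = (\<Sum>i\<in>ends S. \<Sum>j\<in>N i. v i * h j * r i j)"
    by (intro sum.cong refl) (auto simp: N_def lift_def h_def wt_def dest: ends_new(1))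
  have old: "(\<Sum>(i, j)\<in>?P. h i * lift S i v j * r i j) = (\<Sum>(i, j)\<in>?P. h i * v j * r i j)"
    by (intro sum.cong refl) (auto simp: lift_def)
  have swap: "(\<Sum>(i, j)\<in>?P. f i j) = (\<Sum>(i, j)\<in>?P. f j i)" for f :: "_ \<Rightarrow> _ \<Rightarrow> real"
    by (rule sum.reindex_bij_witness[of _ prod.swap prod.swap]) auto
  define D where "D = (\<Sum>(i, j)\<in>?P. h i * v j * ((v j - v i) * U i j))"
  have "(\<Sum>(i, j)\<in>?P. h i * v j * r i j) - (\<Sum>(i, j)\<in>?P. v i * h j * r i j)
      = (\<Sum>(i, j)\<in>?P. h i * v j * r i j - h i * v j * r j i)"
    by (subst (2) swap) (simp add: sum_subtractf split_def mult.commute)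
  also have "\<dots> = D"
    unfolding D_def by (intro sum.cong refl) (auto simp: rdiff right_diff_distrib[symmetric])
  finally have diff: "(\<Sum>(i, j)\<in>?P. h i * v j * r i j) - (\<Sum>(i, j)\<in>?P. v i * h j * r i j) = D" .
  \<comment> \<open>Symmetrising in \<open>i\<close> and \<open>j\<close> and using
    \<open>Usign\<close> produces the squares.\<close>
  have "2 * D = (\<Sum>(i, j)\<in>?P. h i * v j * ((v j - v i) * U i j) + h j * v i * ((v i - v j) * U j i))"
    unfolding mult_2 D_def by (subst (2) swap) (simp add: sum.distrib split_def)
  also have "\<dots> \<ge> 0"
  proof (intro sum_nonneg, clarify)
    fix u s u' s' assume p: "(u, s) \<in> ends S" "(u', s') \<in> ends S" "fst (fst ((u, s), (u', s'))) \<noteq> fst (snd ((u, s), (u', s')))"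
    let ?i = "(u, s)" and ?j = "(u', s')"
    have "h ?i * v ?j * ((v ?j - v ?i) * U ?i ?j) + h ?j * v ?i * ((v ?i - v ?j) * U ?j ?i)
        = h ?i * (v ?j - v ?i)\<^sup>2 * U ?i ?j"
    proof (cases "U ?i ?j = 0")
      case False
      then have "h ?i = h ?j" using p by (intro Usign) auto
      then show ?thesis by (simp add: Usym[of ?j ?i] power2_eq_square algebra_simps)
    qed (simp add: Usym[of ?j ?i])
    also have "\<dots> \<ge> 0" using U0 e by (simp add: h_def wt_def)
    finally show "0 \<le> h ?i * v ?j * ((v ?j - v ?i) * U ?i ?j) + h ?j * v ?i * ((v ?i - v ?j) * U ?j ?i)" .
  qed
  finally show ?thesis using diff left right new old by (simp add: h_def)
qed

section \<open>Hyperbolicity by induction on the number of elements\<close>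

text \<open>Let \<open>x\<close> and \<open>y\<close> be the elements besides \<open>z\<close>. If
  they are incomparable, the form is a symmetrised product of two linear functionals. Otherwise
  there are at most two ends; if both exist, the matrix has off-diagonal entry 1 and diagonal
  entries at most 1.\<close>

lemma hyperbolic_form_3:
  assumes S: "z \<in> S" "card S = 3"
  shows "hyperbolic (form e [] S)"
proof -
  have fin: "finite S" using S card.infinite by fastforce
  have "card (S - {z}) = 2" using S by simp
  then obtain x y where xy: "S - {z} = {x, y}" "x \<noteq> y" by (auto simp: card_2_iff)
  then have S_eq: "S = {z, x, y}" "x \<noteq> z" "y \<noteq> z" using S by auto
  have new_le: "entry e [] S i i \<in> {0..1}" if i: "i \<in> ends S" for i
  proof -
    define w where "w = (if fst i = x then y else x)"
    have "j = (w, snd i)" if "j \<in> ends (S - {fst i}) - ends S" for j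
      using that ends_new(1)[OF i, of j] endsD[of j] S_eq i endsD[OF i] by (cases j) (auto simp: w_def)
    then have "ends (S - {fst i}) - ends S \<subseteq> {(w, snd i)}" by blast
    then have "card (ends (S - {fst i}) - ends S) \<le> 1"
      using card_mono[of "{(w, snd i)}"] by fastforce
    then show ?thesis by (simp add: entry_def)
  qed
  show ?thesis
  proof (cases "lt x y \<or> lt y x")
    case False
    have entry: "entry e [] S i j = (if fst i \<noteq> fst j then 1 else 0)" if "i \<in> ends S" for i j
    proof -
      have new: "ends (S - {fst i}) - ends S = {}"
        using that False S_eq lt_irrefl by (fastforce simp: ends_def split: if_splits)
      show ?thesis unfolding entry_def new by simp
    qed
    define X where "X v = (\<Sum>i\<in>{i \<in> ends S. fst i = x}. v i)" for v :: "_ \<Rightarrow> real"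
    define Y where "Y v = (\<Sum>i\<in>{i \<in> ends S. fst i = y}. v i)" for v :: "_ \<Rightarrow> real"
    have fst_xy: "fst i = x \<or> fst i = y" if "i \<in> ends S" for i using endsD[OF that] S_eq by auto
    have "form e [] S u v = X u * Y v + Y u * X v" for u v
    proof -
      have ends_eq: "ends S = {i \<in> ends S. fst i = x} \<union> {i \<in> ends S. fst i = y}" using fst_xy by auto
      have action: "action e [] S v i = (if fst i = x then Y v else X v)" if i: "i \<in> ends S" for i
      proof -
        have "action e [] S v i = (\<Sum>j\<in>{j \<in> ends S. fst j = (if fst i = x then y else x)}. v j)"
        proof -
          have "{j \<in> ends S. fst j = (if fst i = x then y else x)} = {j \<in> ends S. fst i \<noteq> fst j}"
            using fst_xy[OF i] fst_xy xy(2) by (intro Collect_cong) metis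
          then show ?thesis
            unfolding action_entry[OF fin i] using fin i
            by (simp add: sum.inter_filter entry) (intro sum.cong refl, simp)
        qed
        then show ?thesis by (simp add: X_def Y_def)
      qed
      have "form e [] S u v = (\<Sum>i\<in>{i \<in> ends S. fst i = x}. u i * action e [] S v i)
          + (\<Sum>i\<in>{i \<in> ends S. fst i = y}. u i * action e [] S v i)"
        unfolding form_def by (subst ends_eq, rule sum.union_disjoint) (use fin xy in auto)
      then show ?thesis using xy by (simp add: action X_def Y_def sum_distrib_right)
    qed
    then have eq: "(form e [] S u v)\<^sup>2 - form e [] S u u * form e [] S v v = (X u * Y v - Y u * X v)\<^sup>2" for u v
      by (simp add: power2_eq_square algebra_simps)
    have "form e [] S u u * form e [] S v v \<le> (form e [] S u v)\<^sup>2" for u v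
      using zero_le_power2[of "X u * Y v - Y u * X v"] unfolding eq[symmetric] by linarith
    then show ?thesis by (simp add: hyperbolic_def)
  next
    case True
    define a where "a = (if lt x y then (y, True) else (x, True))"
    define b where "b = (if lt x y then (x, False) else (y, False))"
    have sub: "ends S \<subseteq> {a, b}" and ab: "fst a \<noteq> fst b"
      using True S_eq lt_irrefl lt_trans xy by (auto simp: ends_def a_def b_def split: if_splits)
    \<comment> \<open>Extension by zero treats the cases in which \<open>a\<close> or
      \<open>b\<close> is blocked by \<open>z\<close> along with the full one.\<close>
    define m where "m i j = (if i \<in> ends S \<and> j \<in> ends S then entry e [] S i j else 0)" for i j
    have "form e [] S u v = quad {a, b} m u v" for u v
      unfolding form_quad[OF fin] quad_def using sub
      by (intro sum.mono_neutral_cong_left) (auto intro!: sum.mono_neutral_cong_left simp: m_def)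
    then have form: "form e [] S u v = m a a * u a * v a + m a b * (u a * v b + u b * v a) + m b b * u b * v b" for u v
    proof -
      have "a \<noteq> b" using ab by auto
      moreover have "m b a = m a b" by (auto simp: m_def entry_sym)
      ultimately show ?thesis
        unfolding \<open>\<And>u v. form e [] S u v = quad {a, b} m u v\<close> quad_def by (simp add: algebra_simps)
    qed
    have det: "m a a * m b b \<le> (m a b)\<^sup>2"
    proof (cases "a \<in> ends S \<and> b \<in> ends S")
      case True
      then have "m a a * m b b \<le> 1 * 1" using new_le unfolding m_def by (intro mult_mono) auto
      moreover have "m a b = 1" using True ab by (auto simp: m_def entry_def)
      ultimately show ?thesis by simp
    qed (auto simp: m_def)
    have eq: "(form e [] S u v)\<^sup>2 - form e [] S u u * form e [] S v v
      = ((m a b)\<^sup>2 - m a a * m b b) * (u a * v b - u b * v a)\<^sup>2" for u v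
      unfolding form by (simp add: power2_eq_square algebra_simps)
    have "form e [] S u u * form e [] S v v \<le> (form e [] S u v)\<^sup>2" for u v
    proof -
      have "0 \<le> ((m a b)\<^sup>2 - m a a * m b b) * (u a * v b - u b * v a)\<^sup>2" using det by simp
      then show ?thesis unfolding eq[symmetric] by linarith
    qed
    then show ?thesis by (simp add: hyperbolic_def)
  qed
qed

text \<open>Bochner's method with \<open>h = wt e b\<close>: by induction the form in each row is
  hyperbolic, and its reversed Cauchy-Schwarz inequality bounds the right side of
  \<open>form_pullback\<close> as \<open>spec\<close> demands. The assumption \<open>e > 0\<close>
  provides positive weights and a connected graph.\<close>

lemma hyperbolic_form_pos:
  assumes e: "e > 0" and "z \<in> S" "card S = length bs + 3"
  shows "hyperbolic (form e bs S)"
  using assms(2-)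
proof (induction bs arbitrary: S)
  case Nil
  then show ?case by (simp add: hyperbolic_form_3)
next
  case (Cons b bs)
  have fin: "finite S" using Cons.prems card.infinite by fastforce
  have rowD: "(\<Sum>j\<in>ends S. entry e (b # bs) S i j * v j) = action e (b # bs) S v i" if "i \<in> ends S" for i v
    by (simp add: action_entry[OF fin that])
  have D: "action e (b # bs) S (wt e b) i = form e bs (S - {fst i}) (wt e b) (wt e b)" if "i \<in> ends S" for i
    using that fin by (simp only: action_Cons) (auto intro!: form_cong simp: lift_wt)
  have D_pos: "action e (b # bs) S (wt e b) i > 0" if "i \<in> ends S" for i
    unfolding action_wt[OF that] using Cons.prems fin e endsD[OF that] by (intro vol_pos) auto
  have entry_pos: "entry e (b # bs) S i j > 0" if "i \<in> ends S" "j \<in> ends S" "fst i \<noteq> fst j" for i j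
  proof -
    have "i \<noteq> j" using that by auto
    then show ?thesis using that endsD[of i S] endsD[of j S] Cons.prems fin e unfolding entry_def
      by (simp del: vol.simps) (rule vol_pos, auto)
  qed
  show ?case
    unfolding form_quad[OF fin]
  proof (rule hyperbolic_of_bochner[where h = "wt e b"])
    show "wt e b i > 0" for i using e by (simp add: wt_def)
    show "(\<Sum>j\<in>ends S. entry e (b # bs) S i j * wt e b j) > 0" if "i \<in> ends S" for i
      using D_pos rowD that by simp
    show "entry e (b # bs) S i j > 0 \<or> (\<exists>k\<in>ends S. entry e (b # bs) S i k > 0 \<and> entry e (b # bs) S k j > 0)"
      if ij: "i \<in> ends S" "j \<in> ends S" "i \<noteq> j" for i j
    proof (cases "fst i = fst j")
      case True
      \<comment> \<open>The two ends of one element are joined through \<open>k\<close>. A new end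
        would have to lie on both sides at once, so \<open>k\<close> is an end of
        \<open>S\<close>.\<close>
      obtain k where k: "k \<in> ends (S - {fst i})"
        using ends_nonempty[of "S - {fst i}"] Cons.prems fin endsD[OF ij(1)] by fastforce
      have "k \<in> ends S"
      proof (rule ccontr)
        assume "k \<notin> ends S"
        then have "snd k = snd i" "snd k = snd j"
          using ends_new(1)[of i S k] ends_new(1)[of j S k] ij k True by auto
        then show False using True ij by (simp add: prod_eq_iff)
      qed
      then show ?thesis using entry_pos[of i k] entry_pos[of k j] endsD[OF k] ij True by auto
    qed (use entry_pos ij in auto)
    show "quad (ends S) (entry e (b # bs) S) v v
      \<le> (\<Sum>i\<in>ends S. wt e b i * (\<Sum>j\<in>ends S. entry e (b # bs) S i j * v j)\<^sup>2
          / (\<Sum>j\<in>ends S. entry e (b # bs) S i j * wt e b j))" for v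
    proof -
      have "quad (ends S) (entry e (b # bs) S) v v
        \<le> (\<Sum>i\<in>ends S. wt e b i * form e bs (S - {fst i}) (lift S i v) (lift S i v))"
        using form_pullback[OF fin, of e b bs v] e by (simp add: form_quad[OF fin])
      also have "\<dots> \<le> (\<Sum>i\<in>ends S. wt e b i * ((action e (b # bs) S v i)\<^sup>2 / action e (b # bs) S (wt e b) i))"
      proof (intro sum_mono mult_left_mono)
        fix i assume i: "i \<in> ends S"
        show "0 \<le> wt e b i" using e by (simp add: wt_def)
        have "hyperbolic (form e bs (S - {fst i}))"
          using Cons.prems endsD[OF i] fin by (intro Cons.IH) auto
        then have "form e bs (S - {fst i}) (lift S i v) (lift S i v) * action e (b # bs) S (wt e b) i
          \<le> (action e (b # bs) S v i)\<^sup>2"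
          using D_pos[OF i] unfolding hyperbolic_def D[OF i] action_Cons[OF i, where v = v]
          by (cases "form e bs (S - {fst i}) (lift S i v) (lift S i v) > 0")
            (simp, rule order_trans[OF mult_nonpos_nonneg], auto)
        then show "form e bs (S - {fst i}) (lift S i v) (lift S i v)
          \<le> (action e (b # bs) S v i)\<^sup>2 / action e (b # bs) S (wt e b) i"
          using D_pos[OF i] by (simp add: pos_le_divide_eq)
      qed
      finally show ?thesis using rowD by simp
    qed
  qed (use fin e in \<open>auto intro: entry_sym entry_nonneg\<close>)
qed

text \<open>\<open>form e bs S\<close> is continuous in \<open>e\<close>, strict positivity at 0
  persists for small \<open>e > 0\<close>, and the inequality survives the limit.\<close>

lemma hyperbolic_form:
  assumes "z \<in> S" "card S = length bs + 3"
  shows "hyperbolic (form 0 bs S)"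
proof -
  have vol: "((\<lambda>e. vol e bs T) \<longlongrightarrow> vol 0 bs T) (at_right 0)" for bs T
  proof (induction bs arbitrary: T)
    case (Cons b bs)
    have "((\<lambda>e. wt e b i) \<longlongrightarrow> wt 0 b i) (at_right 0)" for i by (auto simp: wt_def)
    then show ?case using Cons by (auto intro!: tendsto_intros)
  qed simp
  have form: "((\<lambda>e. form e bs S x y) \<longlongrightarrow> form 0 bs S x y) (at_right 0)" for x y
    unfolding form_def action_def by (intro tendsto_intros vol)
  show ?thesis
    unfolding hyperbolic_def
  proof (intro allI impI)
    fix x y assume pos: "form 0 bs S x x > 0" "form 0 bs S y y > 0"
    have "eventually (\<lambda>e. form e bs S x x > 0 \<and> form e bs S y y > 0 \<and> e > 0) (at_right 0)"
      using order_tendstoD(1)[OF form pos(1)] order_tendstoD(1)[OF form pos(2)]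
      by (auto intro!: eventually_conj eventually_at_right_less)
    then have "eventually (\<lambda>e. form e bs S x x * form e bs S y y \<le> (form e bs S x y)\<^sup>2) (at_right 0)"
      by eventually_elim (use hyperbolic_form_pos[OF _ assms] in \<open>auto simp: hyperbolic_def\<close>)
    then show "form 0 bs S x x * form 0 bs S y y \<le> (form 0 bs S x y)\<^sup>2"
      by (rule tendsto_le[OF trivial_limit_at_right_real, rotated 2]) (intro tendsto_intros form)+
  qed
qed

section \<open>Counting linear extensions by the position of one element\<close>

text \<open>The order is partial, so sortedness is expressed negatively: no later element lies below
  an earlier one.\<close>

definition exts :: "'a set \<Rightarrow> 'a list set" where
  "exts S = {xs. distinct xs \<and> set xs = S \<and> sorted_wrt (\<lambda>x y. \<not> lt y x) xs}"

definition cut :: "'a set \<Rightarrow> nat \<Rightarrow> ('a list \<times> 'a list) set" where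
  "cut S m = {(p, q). p @ z # q \<in> exts S \<and> length q = m}"

definition cnt :: "'a set \<Rightarrow> nat \<Rightarrow> nat" where
  "cnt S m = card (cut S m)"

lemma finite_exts [simp]: "finite S \<Longrightarrow> finite (exts S)"
  by (rule finite_subset[OF _ finite_subset_distinct[of S]]) (auto simp: exts_def)

lemma length_exts: "xs \<in> exts S \<Longrightarrow> length xs = card S"
  by (auto simp: exts_def distinct_card)

lemma finite_cut [simp]:
  assumes "finite S"
  shows "finite (cut S m)"
proof -
  have "cut S m \<subseteq> (\<lambda>xs. (takeWhile (\<lambda>x. x \<noteq> z) xs, tl (dropWhile (\<lambda>x. x \<noteq> z) xs))) ` exts S"
  proof
    fix pq assume "pq \<in> cut S m"
    then obtain p q where pq: "pq = (p, q)" "p @ z # q \<in> exts S" by (auto simp: cut_def)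
    then have "z \<notin> set p" by (auto simp: exts_def)
    then have "takeWhile (\<lambda>x. x \<noteq> z) (p @ z # q) = p" "dropWhile (\<lambda>x. x \<noteq> z) (p @ z # q) = z # q"
      by (auto simp: takeWhile_append dropWhile_append)
    then show "pq \<in> (\<lambda>xs. (takeWhile (\<lambda>x. x \<noteq> z) xs, tl (dropWhile (\<lambda>x. x \<noteq> z) xs))) ` exts S"
      using pq by force
  qed
  then show ?thesis by (rule finite_surj[OF finite_exts[OF assms]])
qed

text \<open>The conditions on \<open>ys\<close> do not mention \<open>xs\<close>, so admissible
  prefixes and suffixes can be combined freely.\<close>

lemma exts_append_iff:
  "xs @ ys \<in> exts S \<longleftrightarrow> distinct ys \<and> set ys \<subseteq> S \<and> sorted_wrt (\<lambda>x y. \<not> lt y x) ys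
    \<and> (\<forall>x\<in>S - set ys. \<forall>y\<in>set ys. \<not> lt y x) \<and> xs \<in> exts (S - set ys)"
  (is "?l \<longleftrightarrow> ?r")
proof
  assume l: ?l
  then have "S - set ys = set xs" by (auto simp: exts_def)
  with l show ?r by (auto simp: exts_def sorted_wrt_append)
next
  assume r: ?r
  then have "set xs = S - set ys" by (simp add: exts_def)
  with r show ?l by (auto simp: exts_def sorted_wrt_append)
qed

lemma exts_snoc: "xs @ [u] \<in> exts S \<longleftrightarrow> u \<in> S \<and> (\<forall>y\<in>S. \<not> lt u y) \<and> xs \<in> exts (S - {u})"
  unfolding exts_append_iff by (simp add: lt_irrefl) (metis Diff_iff empty_iff insert_iff lt_irrefl)

lemma exts_Cons: "u # xs \<in> exts S \<longleftrightarrow> u \<in> S \<and> (\<forall>y\<in>S. \<not> lt y u) \<and> xs \<in> exts (S - {u})"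
  (is "?l \<longleftrightarrow> ?r")
proof
  assume l: ?l
  then have "S = insert u (set xs)" "u \<notin> set xs" by (auto simp: exts_def)
  with l show ?r by (simp add: exts_def lt_irrefl)
next
  assume r: ?r
  then have "S = insert u (set xs)" "u \<notin> set xs" by (auto simp: exts_def)
  with r show ?l by (simp add: exts_def)
qed

lemma cnt_Suc:
  assumes "finite S"
  shows "cnt S (Suc m) = (\<Sum>i\<in>{i \<in> ends S. snd i}. cnt (S - {fst i}) m)"
proof -
  have "bij_betw (\<lambda>(i, p, q). (p, q @ [fst i])) (SIGMA i:{i \<in> ends S. snd i}. cut (S - {fst i}) m) (cut S (Suc m))"
  proof (rule bij_betw_imageI)
    show "inj_on (\<lambda>(i, p, q). (p, q @ [fst i])) (SIGMA i:{i \<in> ends S. snd i}. cut (S - {fst i}) m)"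
      by (auto simp: inj_on_def)
    show "(\<lambda>(i, p, q). (p, q @ [fst i])) ` (SIGMA i:{i \<in> ends S. snd i}. cut (S - {fst i}) m) = cut S (Suc m)"
    proof (intro equalityI subsetI)
      fix pq assume "pq \<in> (\<lambda>(i, p, q). (p, q @ [fst i])) ` (SIGMA i:{i \<in> ends S. snd i}. cut (S - {fst i}) m)"
      then obtain u p q where "pq = (p, q @ [u])" "(u, True) \<in> ends S" "(p, q) \<in> cut (S - {u}) m" by auto
      then show "pq \<in> cut S (Suc m)"
        using exts_snoc[of "p @ z # q" u S] by (auto simp: cut_def ends_def)
    next
      fix pq assume "pq \<in> cut S (Suc m)"
      then obtain p q u where pq: "pq = (p, q @ [u])" "(p @ z # q) @ [u] \<in> exts S" "length q = m"
        by (auto simp: cut_def length_Suc_conv_rev)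
      moreover from this have "u \<noteq> z" by (auto simp: exts_def)
      ultimately show "pq \<in> (\<lambda>(i, p, q). (p, q @ [fst i])) ` (SIGMA i:{i \<in> ends S. snd i}. cut (S - {fst i}) m)"
        unfolding exts_snoc by (intro image_eqI[of _ _ "((u, True), p, q)"]) (auto simp: ends_def cut_def)
    qed
  qed
  then show ?thesis using assms by (simp add: cnt_def bij_betw_same_card[symmetric] card_SigmaI)
qed

text \<open>The bound on \<open>card S\<close> guarantees an element before \<open>z\<close>, so the
  first element is not \<open>z\<close> and can be removed.\<close>

lemma cnt_first:
  assumes "finite S" "card S \<ge> m + 2"
  shows "cnt S m = (\<Sum>i\<in>{i \<in> ends S. \<not> snd i}. cnt (S - {fst i}) m)"
proof -
  have "bij_betw (\<lambda>(i, p, q). (fst i # p, q)) (SIGMA i:{i \<in> ends S. \<not> snd i}. cut (S - {fst i}) m) (cut S m)"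
  proof (rule bij_betw_imageI)
    show "inj_on (\<lambda>(i, p, q). (fst i # p, q)) (SIGMA i:{i \<in> ends S. \<not> snd i}. cut (S - {fst i}) m)"
      by (auto simp: inj_on_def)
    show "(\<lambda>(i, p, q). (fst i # p, q)) ` (SIGMA i:{i \<in> ends S. \<not> snd i}. cut (S - {fst i}) m) = cut S m"
    proof (intro equalityI subsetI)
      fix pq assume "pq \<in> (\<lambda>(i, p, q). (fst i # p, q)) ` (SIGMA i:{i \<in> ends S. \<not> snd i}. cut (S - {fst i}) m)"
      then obtain u p q where "pq = (u # p, q)" "(u, False) \<in> ends S" "(p, q) \<in> cut (S - {u}) m" by auto
      then show "pq \<in> cut S m"
        using exts_Cons[of u "p @ z # q" S] by (auto simp: cut_def ends_def)
    next
      fix pq assume "pq \<in> cut S m"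
      then obtain p' q where pq': "pq = (p', q)" "p' @ z # q \<in> exts S" "length q = m"
        by (auto simp: cut_def)
      moreover have "p' \<noteq> []" using length_exts[OF pq'(2)] pq' assms by auto
      ultimately obtain u p where pq: "pq = (u # p, q)" "u # p @ z # q \<in> exts S" "length q = m"
        by (cases p') auto
      moreover from this have "u \<noteq> z" by (auto simp: exts_def)
      ultimately show "pq \<in> (\<lambda>(i, p, q). (fst i # p, q)) ` (SIGMA i:{i \<in> ends S. \<not> snd i}. cut (S - {fst i}) m)"
        unfolding exts_Cons by (intro image_eqI[of _ _ "((u, False), p, q)"]) (auto simp: ends_def cut_def)
    qed
  qed
  then show ?thesis using assms by (simp add: cnt_def bij_betw_same_card[symmetric] card_SigmaI)
qed

text \<open>For \<open>e = 0\<close> only removals on the prescribed side survive: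
  \<open>True\<close> removes the last element, \<open>False\<close> the first. What matters in the
  end is how many \<open>True\<close> occur, not where.\<close>

lemma vol_0_eq_cnt:
  assumes "finite S" "z \<in> S" "card S = length bs + 1"
  shows "vol 0 bs S = real (cnt S (length (filter (\<lambda>b. b) bs)))"
  using assms
proof (induction bs arbitrary: S)
  case Nil
  then have "S = {z}" by (metis One_nat_def add_0 card_1_singletonE list.size(3) singletonD)
  then have "cut S 0 = {([], [])}"
    by (auto simp: cut_def exts_def subset_singleton_iff)
  then show ?case by (simp add: cnt_def)
next
  case (Cons b bs)
  let ?m = "length (filter (\<lambda>b. b) bs)"
  have IH: "vol 0 bs (S - {fst i}) = real (cnt (S - {fst i}) ?m)" if "i \<in> ends S" for i
    using Cons endsD[OF that] by (intro Cons.IH) auto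
  have "vol 0 (b # bs) S = (\<Sum>i\<in>ends S. if snd i = b then real (cnt (S - {fst i}) ?m) else 0)"
    by (auto simp: wt_def IH intro!: sum.cong)
  also have "\<dots> = (\<Sum>i\<in>{i \<in> ends S. snd i = b}. real (cnt (S - {fst i}) ?m))"
    using Cons.prems by (simp add: sum.inter_filter)
  finally have *: "vol 0 (b # bs) S = (\<Sum>i\<in>{i \<in> ends S. snd i = b}. real (cnt (S - {fst i}) ?m))" .
  show ?case
  proof (cases b)
    case True
    then show ?thesis using Cons.prems unfolding * by (simp add: cnt_Suc)
  next
    case False
    have "?m + 2 \<le> card S" using Cons.prems by (simp add: le_SucI)
    then show ?thesis using False Cons.prems unfolding * by (simp add: cnt_first[of S ?m])
  qed
qed

section \<open>The Alexandrov-Fenchel inequality for the counts\<close>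

text \<open>The vectors \<open>K1\<close>, \<open>K0\<close> and \<open>s\<close> stand for removing
  a first element, a last element and \<open>x\<close>; their pairings are the five counts. The
  claim is \<open>hyperbolic_triple\<close> with \<open>w = K1\<close>, after dropping the
  nonnegative self-pairing of \<open>s\<close>.\<close>

lemma cnt_cross:
  fixes T :: "'a set" and x :: 'a and j :: nat
  defines "a \<equiv> real (cnt T (j + 1))" and "b \<equiv> real (cnt (T - {x}) j)" and "c \<equiv> real (cnt T j)"
    and "d \<equiv> real (cnt (T - {x}) (j + 1))" and "p \<equiv> real (cnt T (j + 2))"
  assumes T: "finite T" "z \<in> T" "(x, True) \<in> ends T" "j + 3 \<le> card T"
  shows "(c * d - a * b)\<^sup>2 \<le> (a\<^sup>2 - p * c) * b\<^sup>2"
proof (cases "c = 0")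
  case True
  then show ?thesis by (simp add: power_mult_distrib)
next
  case False
  \<comment> \<open>Two further removals bring the number of elements after \<open>z\<close> to
    \<open>j\<close>, \<open>j + 1\<close> or \<open>j + 2\<close>, according to their
    sides.\<close>
  define bs where "bs = replicate j True @ replicate (card T - 3 - j) False"
  have len: "card T = length bs + 3" "length (filter (\<lambda>b. b) bs) = j" using T by (auto simp: bs_def)
  define K0 where "K0 = wt 0 True"
  define K1 where "K1 = wt 0 False"
  define s where "s i = (if i = (x, True) then 1 else 0 :: real)" for i
  let ?B = "quad (ends T) (entry 0 bs T)"
  have B: "form 0 bs T = ?B" by (rule form_quad[OF T(1)])
  have hyp: "hyperbolic ?B" using hyperbolic_form[OF T(2) len(1)] by (simp only: B)
  have sym: "?B u v = ?B v u" for u v by (rule quad_commute) (rule entry_sym)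
  have K: "?B (wt 0 b1) (wt 0 b2) = real (cnt T (length (filter (\<lambda>b. b) (b1 # b2 # bs))))" for b1 b2
  proof -
    have "form 0 bs T (wt 0 b1) (wt 0 b2) = vol 0 (b1 # b2 # bs) T"
      unfolding form_def vol.simps(2)[of 0 b1] by (intro sum.cong refl) (simp add: action_wt)
    then show ?thesis using vol_0_eq_cnt[of T "b1 # b2 # bs"] T len by (simp add: B)
  qed
  have sK: "?B s (wt 0 b1) = real (cnt (T - {x}) (length (filter (\<lambda>b. b) (b1 # bs))))" for b1
  proof -
    have "form 0 bs T s (wt 0 b1) = action 0 bs T (wt 0 b1) (x, True)"
      unfolding form_def s_def using T by (simp add: if_distrib[of "\<lambda>c. c * _"] cong: if_cong)
    also have "\<dots> = vol 0 (b1 # bs) (T - {x})" using action_wt[OF T(3)] by simp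
    also have "\<dots> = real (cnt (T - {x}) (length (filter (\<lambda>b. b) (b1 # bs))))"
      using T len endsD[OF T(3)] by (intro vol_0_eq_cnt) auto
    finally show ?thesis by (simp only: B)
  qed
  have vals: "?B K1 K1 = c" "?B K0 K1 = a" "?B K0 K0 = p" "?B s K1 = b" "?B s K0 = d"
    unfolding K0_def K1_def K sK using len by (simp_all add: a_def b_def c_def d_def p_def)
  have ss: "?B s s \<ge> 0"
    unfolding quad_def s_def by (intro sum_nonneg) (simp add: entry_nonneg)
  have cpos: "c > 0" using False by (simp add: c_def)
  have ineq: "(c * d - a * b)\<^sup>2 \<le> (a\<^sup>2 - p * c) * (b\<^sup>2 - ?B s s * c)"
    using hyperbolic_triple[OF entry_sym hyp, of K1 K0 s] cpos vals sym[of K0 s] by simp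
  have "a\<^sup>2 - p * c \<ge> 0"
  proof (cases "p > 0")
    case True
    then show ?thesis using hyp cpos unfolding hyperbolic_def vals(1-3)[symmetric] by simp
  next
    case False
    then have "p = 0" by (simp add: p_def)
    then show ?thesis by simp
  qed
  then have "(a\<^sup>2 - p * c) * (b\<^sup>2 - ?B s s * c) \<le> (a\<^sup>2 - p * c) * b\<^sup>2"
    using ss cpos by (intro mult_left_mono) auto
  then show ?thesis using ineq by simp
qed

section \<open>Moving one element across \<open>z\<close>\<close>

text \<open>Among \<open>m + 1\<close> elements after \<open>z\<close> some are not above it. The
  first such \<open>y\<close> is moved to just before \<open>z\<close>: the elements it passes are
  above \<open>z\<close>, so none of them is below \<open>y\<close>. Recording
  \<open>length q1\<close> makes the move injective.\<close>

lemma cnt_Suc_le: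
  assumes fin: "finite T"
    and above: "card {v \<in> T. lt z v} \<le> m"
    and bound: "\<And>p q1 y q2. p @ z # q1 @ y # q2 \<in> exts T \<Longrightarrow> length (q1 @ q2) = m \<Longrightarrow>
      \<forall>w\<in>set q1. lt z w \<Longrightarrow> \<not> lt z y \<Longrightarrow> length q1 < N"
  shows "cnt T (Suc m) \<le> N * cnt T m"
proof -
  define R where "R = {(p, q1, y, q2). p @ z # q1 @ y # q2 \<in> exts T \<and> length (q1 @ q2) = m
    \<and> (\<forall>w\<in>set q1. lt z w) \<and> \<not> lt z y}"
  have cover: "cut T (Suc m) \<subseteq> (\<lambda>(p, q1, y, q2). (p, q1 @ y # q2)) ` R"
  proof
    fix pq assume "pq \<in> cut T (Suc m)"
    then obtain p q where pq: "pq = (p, q)" "p @ z # q \<in> exts T" "length q = Suc m"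
      by (auto simp: cut_def)
    have "\<exists>y\<in>set q. \<not> lt z y"
    proof (rule ccontr)
      assume "\<not> (\<exists>y\<in>set q. \<not> lt z y)"
      then have "set q \<subseteq> {v \<in> T. lt z v}" using pq by (auto simp: exts_def)
      then have "card (set q) \<le> m" using above fin card_mono[of "{v \<in> T. lt z v}" "set q"] by simp
      moreover have "card (set q) = Suc m" using pq by (auto simp: exts_def distinct_card)
      ultimately show False by simp
    qed
    then obtain q1 y q2 where "q = q1 @ y # q2" "\<not> lt z y" "\<forall>w\<in>set q1. \<not> \<not> lt z w"
      using split_list_first_prop[of q "\<lambda>y. \<not> lt z y"] by blast
    then show "pq \<in> (\<lambda>(p, q1, y, q2). (p, q1 @ y # q2)) ` R"
      using pq by (intro image_eqI[of _ _ "(p, q1, y, q2)"]) (auto simp: R_def)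
  qed
  have inj: "inj_on (\<lambda>(p, q1, y, q2). ((p @ [y], q1 @ q2), length q1)) R"
    by (auto simp: inj_on_def)
  have sub: "(\<lambda>(p, q1, y, q2). ((p @ [y], q1 @ q2), length q1)) ` R \<subseteq> cut T m \<times> {..<N}"
  proof
    fix x assume "x \<in> (\<lambda>(p, q1, y, q2). ((p @ [y], q1 @ q2), length q1)) ` R"
    then obtain p q1 y q2 where r: "(p, q1, y, q2) \<in> R" and x: "x = ((p @ [y], q1 @ q2), length q1)"
      by auto
    then have e: "p @ z # q1 @ y # q2 \<in> exts T" and q1: "\<forall>w\<in>set q1. lt z w" and y: "\<not> lt z y"
      by (auto simp: R_def)
    have "\<not> lt w y" if "w \<in> set q1" for w using q1 y that lt_trans by blast
    then have "(p @ [y]) @ z # q1 @ q2 \<in> exts T"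
      using e y unfolding exts_def by (auto simp: sorted_wrt_append)
    moreover have "length q1 < N" using bound[OF e] r by (simp add: R_def)
    ultimately show "x \<in> cut T m \<times> {..<N}"
      using r x by (auto simp: cut_def R_def)
  qed
  have finR: "finite R"
    using finite_imageD[OF finite_subset[OF sub] inj] fin by simp
  have "cnt T (Suc m) \<le> card R"
    unfolding cnt_def by (rule surj_card_le[OF finR cover])
  also have "\<dots> \<le> card (cut T m \<times> {..<N})"
    using card_inj_on_le[OF inj sub] fin by simp
  finally show ?thesis by (simp add: cnt_def card_cartesian_product mult.commute)
qed

text \<open>The mirror image: the last element before \<open>z\<close> that is not below
  \<open>z\<close> moves to just behind \<open>z\<close>.\<close>

lemma cnt_le_Suc:
  assumes fin: "finite T"
    and below: "card {v \<in> T. lt v z} + m + 1 < card T"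
    and bound: "\<And>p1 y p2 q. p1 @ y # p2 @ z # q \<in> exts T \<Longrightarrow> \<forall>w\<in>set p2. lt w z \<Longrightarrow>
      \<not> lt y z \<Longrightarrow> length p2 < N"
  shows "cnt T m \<le> N * cnt T (Suc m)"
proof -
  define R where "R = {(p1, y, p2, q). p1 @ y # p2 @ z # q \<in> exts T \<and> length q = m
    \<and> (\<forall>w\<in>set p2. lt w z) \<and> \<not> lt y z}"
  have cover: "cut T m \<subseteq> (\<lambda>(p1, y, p2, q). (p1 @ y # p2, q)) ` R"
  proof
    fix pq assume "pq \<in> cut T m"
    then obtain p q where pq: "pq = (p, q)" "p @ z # q \<in> exts T" "length q = m"
      by (auto simp: cut_def)
    have "\<exists>y\<in>set p. \<not> lt y z"
    proof (rule ccontr)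
      assume "\<not> (\<exists>y\<in>set p. \<not> lt y z)"
      then have "set p \<subseteq> {v \<in> T. lt v z}" using pq by (auto simp: exts_def)
      then have "card (set p) \<le> card {v \<in> T. lt v z}" using fin by (intro card_mono) auto
      moreover have "card (set p) = length p" using pq by (auto simp: exts_def distinct_card)
      ultimately show False using length_exts[OF pq(2)] below pq by simp
    qed
    then obtain p1 y p2 where "p = p1 @ y # p2" "\<not> lt y z" "\<forall>w\<in>set p2. \<not> \<not> lt w z"
      using split_list_last_prop[of p "\<lambda>y. \<not> lt y z"] by blast
    then show "pq \<in> (\<lambda>(p1, y, p2, q). (p1 @ y # p2, q)) ` R"
      using pq by (intro image_eqI[of _ _ "(p1, y, p2, q)"]) (auto simp: R_def)
  qed
  have inj: "inj_on (\<lambda>(p1, y, p2, q). ((p1 @ p2, y # q), length p2)) R"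
    by (auto simp: inj_on_def)
  have sub: "(\<lambda>(p1, y, p2, q). ((p1 @ p2, y # q), length p2)) ` R \<subseteq> cut T (Suc m) \<times> {..<N}"
  proof
    fix x assume "x \<in> (\<lambda>(p1, y, p2, q). ((p1 @ p2, y # q), length p2)) ` R"
    then obtain p1 y p2 q where r: "(p1, y, p2, q) \<in> R" and x: "x = ((p1 @ p2, y # q), length p2)"
      by auto
    then have e: "p1 @ y # p2 @ z # q \<in> exts T" and p2: "\<forall>w\<in>set p2. lt w z" and y: "\<not> lt y z"
      by (auto simp: R_def)
    have "\<not> lt y w" if "w \<in> set p2" for w using p2 y that lt_trans by blast
    then have "(p1 @ p2) @ z # y # q \<in> exts T"
      using e y unfolding exts_def by (auto simp: sorted_wrt_append)
    moreover have "length p2 < N" using bound[OF e p2 y] .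
    ultimately show "x \<in> cut T (Suc m) \<times> {..<N}"
      using r x by (auto simp: cut_def R_def)
  qed
  have finR: "finite R"
    using finite_imageD[OF finite_subset[OF sub] inj] fin by simp
  have "cnt T m \<le> card R"
    unfolding cnt_def by (rule surj_card_le[OF finR cover])
  also have "\<dots> \<le> card (cut T (Suc m) \<times> {..<N})"
    using card_inj_on_le[OF inj sub] fin by simp
  finally show ?thesis by (simp add: cnt_def card_cartesian_product mult.commute)
qed

lemma cnt_pos_above: 
  assumes "finite T" "cnt T m > 0"
  shows "card {v \<in> T. lt z v} \<le> m" "card {v \<in> T. lt v z} + m + 1 \<le> card T" "z \<in> T"
proof -
  obtain p q where pq: "p @ z # q \<in> exts T" "length q = m"
    using assms by (auto simp: cnt_def card_gt_0_iff cut_def)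
  have "{v \<in> T. lt z v} \<subseteq> set q" "{v \<in> T. lt v z} \<subseteq> set p"
    using pq lt_irrefl by (auto simp: exts_def sorted_wrt_append)
  then have "card {v \<in> T. lt z v} \<le> card (set q)" "card {v \<in> T. lt v z} \<le> card (set p)"
    by (auto intro: card_mono)
  moreover have "card (set q) \<le> length q" "card (set p) \<le> length p" by (auto intro: card_length)
  ultimately show "card {v \<in> T. lt z v} \<le> m" "card {v \<in> T. lt v z} + m + 1 \<le> card T"
    using length_exts[OF pq(1)] pq(2) by simp_all
  show "z \<in> T" using pq by (auto simp: exts_def)
qed

text \<open>The thinness bound concerns an element commuting past \<open>z\<close> and past elements comparable to
  \<open>z\<close>: it is incomparable to all of them.\<close>

lemma cnt_step_bounds:
  assumes fin: "finite T"
    and small: "card T \<le> t \<or> (\<forall>y\<in>T - {z}. card {v \<in> T. incomparable lt y v} \<le> t)"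
    and pos: "cnt T m > 0" "cnt T (m + 2) > 0"
  shows "cnt T (m + 1) \<le> min (m + 1) t * cnt T m" "cnt T (m + 1) \<le> t * cnt T (m + 2)"
proof -
  \<comment> \<open>If \<open>T\<close> is small, \<open>y\<close>, \<open>z\<close> and
    \<open>ws\<close> together count as \<open>length ws + 2\<close> elements; if it is thin,
    \<open>z\<close> and \<open>ws\<close> count as \<open>length ws + 1\<close> elements
    incomparable to \<open>y\<close>.\<close>
  have key: "length ws < t"
    if "set (y # z # ws) \<subseteq> T" "distinct (y # z # ws)" "\<And>w. w \<in> set (z # ws) \<Longrightarrow> incomparable lt y w" for y ws
    using small
  proof
    assume "card T \<le> t"
    moreover have "card (set (y # z # ws)) \<le> card T" using fin that by (intro card_mono) auto
    ultimately show ?thesis using distinct_card[OF that(2)] by simp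
  next
    assume "\<forall>y\<in>T - {z}. card {v \<in> T. incomparable lt y v} \<le> t"
    then have "card {v \<in> T. incomparable lt y v} \<le> t" using that by auto
    moreover have "card (set (z # ws)) \<le> card {v \<in> T. incomparable lt y v}"
      using fin that by (intro card_mono) auto
    moreover have "card (set (z # ws)) = length (z # ws)" using that by (intro distinct_card) auto
    ultimately show ?thesis by simp
  qed
  have "cnt T (Suc m) \<le> min (m + 1) t * cnt T m"
  proof (rule cnt_Suc_le[OF fin cnt_pos_above(1)[OF fin pos(1)]])
    fix p q1 y q2 assume e: "p @ z # q1 @ y # q2 \<in> exts T" and len: "length (q1 @ q2) = m"
      and q1: "\<forall>w\<in>set q1. lt z w" and y: "\<not> lt z y"
    have "\<not> lt w y" if "w \<in> set q1" for w using q1 y that lt_trans by blast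
    then have "length q1 < t"
      using e y by (intro key[of y]) (auto simp: exts_def sorted_wrt_append incomparable_def)
    then show "length q1 < min (m + 1) t" using len by simp
  qed
  then show "cnt T (m + 1) \<le> min (m + 1) t * cnt T m" by simp
  have "cnt T (m + 1) \<le> t * cnt T (Suc (m + 1))"
  proof (rule cnt_le_Suc[OF fin])
    show "card {v \<in> T. lt v z} + (m + 1) + 1 < card T" using cnt_pos_above(2)[OF fin pos(2)] by simp
    fix p1 y p2 q assume e: "p1 @ y # p2 @ z # q \<in> exts T" and p2: "\<forall>w\<in>set p2. lt w z" and y: "\<not> lt y z"
    have "\<not> lt y w" if "w \<in> set p2" for w using p2 y that lt_trans by blast
    then show "length p2 < t"
      using e y by (intro key[of y]) (auto simp: exts_def sorted_wrt_append incomparable_def)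
  qed
  then show "cnt T (m + 1) \<le> t * cnt T (m + 2)" by simp
qed

section \<open>Gaps between three elements\<close>

text \<open>List positions start at 0 and values of linear extensions at 1, hence
  \<open>Suc\<close>; \<open>restrict\<close> supplies the required extensionality.\<close>

definition rank :: "'a set \<Rightarrow> 'a list \<Rightarrow> 'a \<Rightarrow> nat" where
  "rank S xs = restrict (\<lambda>x. Suc (THE i. i < length xs \<and> xs ! i = x)) S"

lemma rank_nth:
  assumes "xs \<in> exts S" "i < length xs"
  shows "rank S xs (xs ! i) = Suc i"
proof -
  have "(THE i'. i' < length xs \<and> xs ! i' = xs ! i) = i"
    using assms by (intro the_equality) (auto simp: exts_def nth_eq_iff_index_eq)
  then show ?thesis using assms nth_mem by (auto simp: rank_def exts_def)
qed

lemma ex_rank: "xs \<in> exts S \<Longrightarrow> u \<in> S \<Longrightarrow> \<exists>i<length xs. xs ! i = u \<and> rank S xs u = Suc i"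
  using rank_nth by (auto simp: exts_def in_set_conv_nth)

lemma rank_in_linear_extensions:
  assumes "xs \<in> exts S"
  shows "rank S xs \<in> linear_extensions S lt"
proof -
  have n: "length xs = card S" by (rule length_exts[OF assms])
  have "bij_betw (\<lambda>i. xs ! i) {..<card S} S"
    using assms n by (auto simp: exts_def intro: bij_betw_nth)
  moreover have "bij_betw (rank S xs \<circ> (\<lambda>i. xs ! i)) {..<card S} {1..card S}"
  proof -
    have "bij_betw Suc {..<card S} {1..card S}" by (simp add: bij_betw_def lessThan_atLeast0 image_Suc_atLeastLessThan atLeastLessThanSuc_atLeastAtMost)
    moreover have "bij_betw (rank S xs \<circ> (\<lambda>i. xs ! i)) {..<card S} {1..card S}
        \<longleftrightarrow> bij_betw Suc {..<card S} {1..card S}"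
      using rank_nth[OF assms] n by (intro bij_betw_cong) simp
    ultimately show ?thesis by simp
  qed
  ultimately have bij: "bij_betw (rank S xs) S {1..card S}" using bij_betw_comp_iff by blast
  have "rank S xs u < rank S xs v" if uv: "u \<in> S" "v \<in> S" "lt u v" for u v
  proof -
    obtain i j where ij: "i < length xs" "xs ! i = u" "rank S xs u = Suc i"
      "j < length xs" "xs ! j = v" "rank S xs v = Suc j"
      using ex_rank[OF assms] uv by metis
    have "\<not> j < i"
      using assms ij uv sorted_wrt_nth_less[of "\<lambda>x y. \<not> lt y x" xs j i] by (auto simp: exts_def)
    moreover have "i \<noteq> j" using ij uv lt_irrefl by auto
    ultimately show ?thesis using ij by simp
  qed
  then show ?thesis
    using bij bij_betw_imp_funcset[OF bij] by (auto simp: linear_extensions_def rank_def PiE_def)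
qed

lemma bij_betw_rank:
  assumes "finite S"
  shows "bij_betw (rank S) (exts S) (linear_extensions S lt)"
proof (rule bij_betw_imageI)
  show "inj_on (rank S) (exts S)"
  proof
    fix xs ys assume xs: "xs \<in> exts S" and ys: "ys \<in> exts S" and eq: "rank S xs = rank S ys"
    show "xs = ys"
    proof (rule nth_equalityI)
      show "length xs = length ys" using length_exts xs ys by simp
      fix i assume i: "i < length xs"
      then have "xs ! i \<in> S" using xs by (auto simp: exts_def)
      then show "xs ! i = ys ! i" using ex_rank[OF ys] rank_nth[OF xs i] eq by fastforce
    qed
  qed
  show "rank S ` exts S = linear_extensions S lt"
  proof
    show "rank S ` exts S \<subseteq> linear_extensions S lt" using rank_in_linear_extensions by blast
    show "linear_extensions S lt \<subseteq> rank S ` exts S"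
    proof
      fix L assume L: "L \<in> linear_extensions S lt"
      then have bij: "bij_betw L S {1..card S}" by (simp add: linear_extensions_def)
      define f where "f i = inv_into S L (Suc i)" for i
      have f: "f i \<in> S" "L (f i) = Suc i" if "i < card S" for i
        using that bij_betw_inv_into_right[OF bij, of "Suc i"] bij_betwE[OF bij_betw_inv_into[OF bij]]
        by (auto simp: f_def)
      have fL: "u = f (L u - 1)" "L u - 1 < card S" "L u \<ge> 1" if "u \<in> S" for u
        using that bij_betwE[OF bij] bij_betw_inv_into_left[OF bij that] by (force simp: f_def)+
      define xs where "xs = map f [0..<card S]"
      have len: "length xs = card S" by (simp add: xs_def)
      have "inj_on f {0..<card S}" using f by (metis atLeastLessThan_iff inj_onI nat.inject)
      then have "distinct xs" by (simp add: xs_def distinct_map)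
      moreover have "set xs = S"
        unfolding xs_def using f(1) fL(1,2) by (auto simp: image_iff) (metis atLeastLessThan_iff zero_le)
      moreover have "sorted_wrt (\<lambda>x y. \<not> lt y x) xs"
        unfolding sorted_wrt_iff_nth_less len
      proof (intro allI impI)
        fix i j assume ij: "i < j" "j < card S"
        then have "\<not> L (f j) < L (f i)" using f by simp
        then show "\<not> lt (xs ! j) (xs ! i)" using L ij f(1) by (auto simp: xs_def linear_extensions_def)
      qed
      ultimately have xs: "xs \<in> exts S" by (simp add: exts_def)
      have "rank S xs u = L u" for u
      proof (cases "u \<in> S")
        case True
        then have "u = xs ! (L u - 1)" using fL[OF True] by (simp add: xs_def)
        then show ?thesis using rank_nth[OF xs, of "L u - 1"] fL(2,3)[OF True] len by simp
      next
        case False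
        then show ?thesis using L by (auto simp: rank_def linear_extensions_def PiE_def extensional_def)
      qed
      then show "L \<in> rank S ` exts S" using xs by (metis ext image_eqI)
    qed
  qed
qed

text \<open>\<open>a\<close> and \<open>b\<close> count the elements strictly in between, one less
  than the differences of positions.\<close>

definition gaps :: "'a set \<Rightarrow> 'a \<Rightarrow> 'a \<Rightarrow> nat \<Rightarrow> nat \<Rightarrow> ('a list \<times> 'a list \<times> 'a list \<times> 'a list) set" where
  "gaps S y w a b = {(p, q, r, s). p @ z # q @ y # r @ w # s \<in> exts S \<and> length q = a \<and> length r = b}"

lemma gap_count_eq_card_gaps:
  assumes fin: "finite S" and in_S: "z \<in> S" "y \<in> S" "w \<in> S"
  shows "gap_count S lt z y w (Suc a) (Suc b) = card (gaps S y w a b)"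
proof -
  let ?f = "\<lambda>(p, q, r, s). rank S (p @ z # q @ y # r @ w # s)"
  let ?G = "{L \<in> linear_extensions S lt. int (L y) - int (L z) = int (Suc a) \<and> int (L w) - int (L y) = int (Suc b)}"
  have "bij_betw ?f (gaps S y w a b) ?G"
  proof (rule bij_betw_imageI)
    show "inj_on ?f (gaps S y w a b)"
    proof (rule inj_onI)
      fix g g' assume g: "g \<in> gaps S y w a b" "g' \<in> gaps S y w a b" and eq: "?f g = ?f g'"
      obtain p q r s p' q' r' s' where g_eq: "g = (p, q, r, s)" "g' = (p', q', r', s')"
        by (cases g, cases g') auto
      have e: "p @ z # q @ y # r @ w # s \<in> exts S" "p' @ z # q' @ y # r' @ w # s' \<in> exts S"
        using g by (auto simp: g_eq gaps_def)
      then have "p @ z # q @ y # r @ w # s = p' @ z # q' @ y # r' @ w # s'"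
        using eq bij_betw_imp_inj_on[OF bij_betw_rank[OF fin]] by (auto simp: g_eq inj_on_def)
      moreover have "z \<notin> set p" "z \<notin> set p'" "z \<notin> set (q @ y # r @ w # s)" "z \<notin> set (q' @ y # r' @ w # s')"
        using e by (auto simp: exts_def)
      ultimately have "p = p'" "q @ y # r @ w # s = q' @ y # r' @ w # s'"
        by (metis append_Cons_eq_iff)+
      then show "g = g'" using g by (auto simp: g_eq gaps_def)
    qed
    show "?f ` gaps S y w a b = ?G"
    proof (intro equalityI subsetI)
      fix L assume "L \<in> ?f ` gaps S y w a b"
      then obtain p q r s where L: "L = rank S (p @ z # q @ y # r @ w # s)"
        and e: "p @ z # q @ y # r @ w # s \<in> exts S" and len: "length q = a" "length r = b"
        by (auto simp: gaps_def)
      have "L z = Suc (length p)"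
        using rank_nth[OF e, of "length p"] L by (simp add: nth_append)
      moreover have "L y = Suc (length p + a + 1)"
        using rank_nth[OF e, of "length p + a + 1"] L len by (simp add: nth_append)
      moreover have "L w = Suc (length p + a + 1 + b + 1)"
        using rank_nth[OF e, of "length p + a + 1 + b + 1"] L len by (simp add: nth_append)
      ultimately show "L \<in> ?G" using rank_in_linear_extensions[OF e] L by simp
    next
      fix L assume L: "L \<in> ?G"
      then obtain xs where xs: "xs \<in> exts S" "L = rank S xs"
        using bij_betw_imp_surj_on[OF bij_betw_rank[OF fin]] by blast
      obtain i j k where ijk: "i < length xs" "xs ! i = z" "L z = Suc i" "j < length xs" "xs ! j = y" "L y = Suc j"
        "k < length xs" "xs ! k = w" "L w = Suc k"
        using ex_rank[OF xs(1)] in_S xs(2) by metis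
      have j: "j = Suc i + a" and k: "k = Suc j + b" using L ijk by auto
      define u where "u = drop (Suc i) xs"
      define v where "v = drop (Suc j) xs"
      have "xs = take i xs @ z # u" using id_take_nth_drop[OF ijk(1)] ijk(2) by (simp add: u_def)
      moreover have "u = take a u @ y # v"
      proof -
        have "a < length u" "u ! a = y" using ijk j by (auto simp: u_def)
        moreover have "drop (Suc a) u = v" by (simp add: u_def v_def j add.commute)
        ultimately show ?thesis using id_take_nth_drop[of a u] by simp
      qed
      moreover have "v = take b v @ w # drop (Suc b) v"
      proof -
        have "b < length v" "v ! b = w" using ijk k by (auto simp: v_def)
        then show ?thesis using id_take_nth_drop[of b v] by simp
      qed
      ultimately have xs_eq: "xs = take i xs @ z # take a u @ y # take b v @ w # drop (Suc b) v" by metis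
      moreover have "length (take a u) = a" "length (take b v) = b"
        using ijk j k by (auto simp: u_def v_def)
      ultimately have "(take i xs, take a u, take b v, drop (Suc b) v) \<in> gaps S y w a b"
        using xs by (simp add: gaps_def)
      then show "L \<in> ?f ` gaps S y w a b" using xs xs_eq by (metis (no_types, lifting) case_prod_conv image_eqI)
    qed
  qed
  then show ?thesis by (simp add: gap_count_def bij_betw_same_card)
qed

section \<open>Sorting linear extensions by the part from \<open>y\<close> on\<close>

text \<open>The gap between \<open>z\<close> and \<open>y\<close> is left open, so one index set
  serves all values of the first gap.\<close>

definition suffixes :: "'a set \<Rightarrow> 'a \<Rightarrow> 'a \<Rightarrow> nat \<Rightarrow> ('a list \<times> 'a list) set" where
  "suffixes S y w b = {(r, s). length r = b \<and> (\<exists>p q. p @ z # q @ y # r @ w # s \<in> exts S)}"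

definition rest :: "'a set \<Rightarrow> 'a \<Rightarrow> 'a \<Rightarrow> 'a list \<times> 'a list \<Rightarrow> 'a set" where
  "rest S y w rs = S - set (y # fst rs @ w # snd rs)"

lemma finite_suffixes:
  assumes "finite S"
  shows "finite (suffixes S y w b)"
proof (rule finite_subset)
  show "suffixes S y w b \<subseteq> {xs. set xs \<subseteq> S \<and> distinct xs} \<times> {xs. set xs \<subseteq> S \<and> distinct xs}"
    by (auto simp: suffixes_def exts_def)
  show "finite \<dots>" using assms by (simp add: finite_subset_distinct)
qed

text \<open>By \<open>exts_append_iff\<close>, once a suffix is admissible, every extension of the
  remaining elements can precede it.\<close>

lemma card_gaps:
  assumes fin: "finite S"
  shows "card (gaps S y w a b) = (\<Sum>rs\<in>suffixes S y w b. cnt (rest S y w rs) a)"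
proof -
  have split: "p @ z # q @ y # r @ w # s \<in> exts S \<longleftrightarrow> p @ z # q \<in> exts (rest S y w (r, s))"
    if mem: "(r, s) \<in> suffixes S y w b" for p q r s
  proof -
    obtain p' q' where "(p' @ z # q') @ (y # r @ w # s) \<in> exts S" using mem by (auto simp: suffixes_def)
    then show ?thesis
      using exts_append_iff[of "p' @ z # q'" "y # r @ w # s" S] exts_append_iff[of "p @ z # q" "y # r @ w # s" S]
      by (simp add: rest_def)
  qed
  have "bij_betw (\<lambda>((r, s), (p, q)). (p, q, r, s)) (SIGMA rs:suffixes S y w b. cut (rest S y w rs) a) (gaps S y w a b)"
  proof (rule bij_betw_imageI)
    show "inj_on (\<lambda>((r, s), (p, q)). (p, q, r, s)) (SIGMA rs:suffixes S y w b. cut (rest S y w rs) a)"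
      by (auto simp: inj_on_def)
    show "(\<lambda>((r, s), (p, q)). (p, q, r, s)) ` (SIGMA rs:suffixes S y w b. cut (rest S y w rs) a) = gaps S y w a b"
    proof (intro equalityI subsetI)
      fix g assume "g \<in> (\<lambda>((r, s), (p, q)). (p, q, r, s)) ` (SIGMA rs:suffixes S y w b. cut (rest S y w rs) a)"
      then obtain p q r s where "g = (p, q, r, s)" "(r, s) \<in> suffixes S y w b" "(p, q) \<in> cut (rest S y w (r, s)) a"
        by auto
      then show "g \<in> gaps S y w a b" using split[of r s p q] by (auto simp: gaps_def cut_def suffixes_def)
    next
      fix g assume "g \<in> gaps S y w a b"
      then obtain p q r s where g: "g = (p, q, r, s)" "p @ z # q @ y # r @ w # s \<in> exts S" "length q = a" "length r = b"
        by (auto simp: gaps_def)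
      then have "(r, s) \<in> suffixes S y w b" by (auto simp: suffixes_def)
      then show "g \<in> (\<lambda>((r, s), (p, q)). (p, q, r, s)) ` (SIGMA rs:suffixes S y w b. cut (rest S y w rs) a)"
        using g split[of r s p q] by (intro image_eqI[of _ _ "((r, s), (p, q))"]) (auto simp: cut_def)
    qed
  qed
  then have "card (gaps S y w a b) = card (SIGMA rs:suffixes S y w b. cut (rest S y w rs) a)"
    by (simp add: bij_betw_same_card)
  also have "\<dots> = (\<Sum>rs\<in>suffixes S y w b. cnt (rest S y w rs) a)"
    unfolding cnt_def using fin finite_suffixes[OF fin]
    by (intro card_SigmaI) (auto simp: rest_def)
  finally show ?thesis .
qed

text \<open>The elements that neither \<open>y\<close> nor \<open>w\<close> keeps out of the stretch
  from \<open>y\<close> to \<open>w\<close>.\<close>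

definition between :: "'a set \<Rightarrow> 'a \<Rightarrow> 'a \<Rightarrow> 'a set" where
  "between S y w = {x \<in> S. x \<noteq> y \<and> x \<noteq> w \<and> \<not> lt x y \<and> \<not> lt w x}"

lemma suffixes_rest:
  assumes fin: "finite S" and chain: "lt z y" "lt y w" and rs: "(r, s) \<in> suffixes S y w b"
  shows "set r \<subseteq> between S y w" "card (set r) = b"
    and "{x \<in> S. lt x y} \<subseteq> rest S y w (r, s)"
    and "rest S y w (r, s) \<subseteq> {x \<in> S. lt x y} \<union> (between S y w - set r)"
proof -
  obtain p q where e: "p @ z # q @ y # r @ w # s \<in> exts S" and len: "length r = b"
    using rs by (auto simp: suffixes_def)
  have S: "S = set (p @ z # q @ y # r @ w # s)" and dist: "distinct (p @ z # q @ y # r @ w # s)"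
    using e by (auto simp: exts_def)
  have R: "rest S y w (r, s) = set (p @ z # q)"
    using dist unfolding rest_def S by auto
  show "card (set r) = b" using dist len by (simp add: distinct_card)
  show "set r \<subseteq> between S y w"
    using e dist unfolding between_def S by (auto simp: exts_def sorted_wrt_append)
  show "{x \<in> S. lt x y} \<subseteq> rest S y w (r, s)"
  proof clarify
    fix x assume x: "x \<in> S" "lt x y"
    have "x \<noteq> y" using x lt_irrefl by blast
    moreover have "x \<noteq> w" using x chain lt_trans lt_irrefl by blast
    moreover have "x \<notin> set r" "x \<notin> set s"
      using e x by (auto simp: exts_def sorted_wrt_append)
    ultimately show "x \<in> rest S y w (r, s)" using x by (simp add: rest_def)
  qed
  show "rest S y w (r, s) \<subseteq> {x \<in> S. lt x y} \<union> (between S y w - set r)"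
  proof
    fix x assume x: "x \<in> rest S y w (r, s)"
    then have "\<not> lt w x" using e unfolding R by (auto simp: exts_def sorted_wrt_append)
    then show "x \<in> {x \<in> S. lt x y} \<union> (between S y w - set r)"
      using x by (auto simp: rest_def between_def)
  qed
qed

text \<open>With \<open>N = min (m + 1) t * t\<close> the step bounds give
  \<open>a\<^sup>2 \<le> N * p * c\<close>. Then \<open>cnt_cross\<close> bounds
  \<open>c * d - a * b\<close> by \<open>(1 - 1 / (2 * N)) * a * b\<close>, so \<open>c * d\<close>
  stays below twice \<open>a * b\<close> by a definite factor.\<close>

lemma cnt_ratio:
  assumes fin: "finite T" and z: "z \<in> T" and x: "(x, True) \<in> ends T" and t: "t \<ge> 1"
    and small: "card T \<le> t \<or> (\<forall>y\<in>T - {z}. card {v \<in> T. incomparable lt y v} \<le> t)"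
  shows "real (cnt T (m + 1)) * real (cnt (T - {x}) m)
    \<ge> real (cnt T m) * real (cnt (T - {x}) (m + 1)) * (1 / 2 + 1 / (8 * real (min (m + 1) t * t)))"
proof (cases "cnt T m = 0 \<or> cnt (T - {x}) (m + 1) = 0")
  case True
  then show ?thesis by auto
next
  case False
  define a b c d p where abcdp: "a = real (cnt T (m + 1))" "b = real (cnt (T - {x}) m)"
    "c = real (cnt T m)" "d = real (cnt (T - {x}) (m + 1))" "p = real (cnt T (m + 2))"
  define N where "N = real (min (m + 1) t * t)"
  have "min (m + 1) t * t \<ge> 1" using t by simp
  then have N: "N \<ge> 1" unfolding N_def by linarith
  \<comment> \<open>Appending \<open>x\<close>, which can come last, to an extension of
    \<open>T - {x}\<close> yields one of \<open>T\<close>; thus \<open>p > 0\<close>.\<close>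
  have "cnt (T - {x}) (m + 1) \<le> cnt T (Suc (m + 1))"
    unfolding cnt_Suc[OF fin] using x fin
    by (intro order_trans[OF _ member_le_sum[of "(x, True)"]]) auto
  then have pos: "cnt T m > 0" "cnt T (m + 2) > 0" using False by auto
  have "m + 3 \<le> card T" using cnt_pos_above(2)[OF fin pos(2)] by simp
  then have cross: "(c * d - a * b)\<^sup>2 \<le> (a\<^sup>2 - p * c) * b\<^sup>2"
    unfolding abcdp using cnt_cross[OF fin z x, of m] by simp
  note step = cnt_step_bounds[OF fin small pos]
  have "a * a \<le> (real (min (m + 1) t) * c) * (real t * p)"
    unfolding abcdp
    by (intro mult_mono) (use step in \<open>simp_all only: of_nat_mult[symmetric] of_nat_le_iff of_nat_0_le_iff\<close>)
  then have "a\<^sup>2 \<le> N * (p * c)" by (simp add: N_def power2_eq_square mult_ac)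
  then have "a\<^sup>2 / N \<le> p * c" using N by (simp add: pos_divide_le_eq mult.commute)
  then have "(a\<^sup>2 - p * c) * b\<^sup>2 \<le> (a\<^sup>2 - a\<^sup>2 / N) * b\<^sup>2" by (intro mult_right_mono) auto
  also have "\<dots> = (1 - 1 / N) * (a * b)\<^sup>2" by (simp add: power_mult_distrib algebra_simps)
  also have "\<dots> \<le> (1 - 1 / (2 * N))\<^sup>2 * (a * b)\<^sup>2"
  proof (intro mult_right_mono)
    have "(1 - 1 / (2 * N))\<^sup>2 = 1 - 1 / N + (1 / (2 * N))\<^sup>2" by (simp add: power2_diff)
    then show "1 - 1 / N \<le> (1 - 1 / (2 * N))\<^sup>2" by simp
  qed simp
  finally have "(c * d - a * b)\<^sup>2 \<le> ((1 - 1 / (2 * N)) * (a * b))\<^sup>2"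
    using cross by (simp add: power_mult_distrib)
  moreover have "0 \<le> (1 - 1 / (2 * N)) * (a * b)"
    using N by (intro mult_nonneg_nonneg) (auto simp: abcdp)
  ultimately have "c * d - a * b \<le> (1 - 1 / (2 * N)) * (a * b)"
    by (rule power2_le_imp_le)
  then have le: "c * d \<le> (2 - 1 / (2 * N)) * (a * b)" by (simp add: algebra_simps)
  \<comment> \<open>The constant is the inverse of \<open>2 - 1 / (2 * N)\<close> to first order in
    \<open>1 / N\<close>: the product of the two is
    \<open>1 - (1 / (4 * N))\<^sup>2\<close>.\<close>
  have "c * d * (1 / 2 + 1 / (8 * N)) \<le> (2 - 1 / (2 * N)) * (a * b) * (1 / 2 + 1 / (8 * N))"
    using le N by (intro mult_right_mono) auto
  also have "\<dots> = (a * b) * (1 - (1 / (4 * N))\<^sup>2)"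
    using N by (simp add: power2_eq_square field_simps)
  also have "\<dots> \<le> (a * b) * 1" by (intro mult_left_mono) (auto simp: abcdp)
  finally show ?thesis by (simp add: abcdp N_def)
qed

lemma exts_nonempty: "finite S \<Longrightarrow> exts S \<noteq> {}"
proof (induction "card S" arbitrary: S)
  case 0
  then have "[] \<in> exts S" by (simp add: exts_def)
  then show ?case by blast
next
  case (Suc n)
  obtain u where u: "u \<in> S" "\<And>y. y \<in> S \<Longrightarrow> \<not> lt u y"
    using ex_maximal[of S] Suc by (metis card.empty nat.distinct(1))
  obtain xs where "xs \<in> exts (S - {u})" using Suc.hyps(1)[of "S - {u}"] Suc u by fastforce
  then have "xs @ [u] \<in> exts S" using u by (simp add: exts_snoc)
  then show ?case by blast
qed

section \<open>Initial segments and the exchange of gaps\<close>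

definition down :: "'a set \<Rightarrow> 'a set \<Rightarrow> bool" where
  "down S I \<longleftrightarrow> I \<subseteq> S \<and> (\<forall>v\<in>I. \<forall>u\<in>S. lt u v \<longrightarrow> u \<in> I)"

text \<open>The positions of \<open>z\<close>, \<open>y\<close>, \<open>w\<close> in a linear extension are encoded by the initial segments
  ending at these elements.\<close>

definition config :: "'a set \<Rightarrow> 'a \<Rightarrow> 'a \<Rightarrow> 'a set \<Rightarrow> 'a set \<Rightarrow> 'a set \<Rightarrow> bool" where
  "config S y w I J K \<longleftrightarrow> down S I \<and> down S J \<and> down S K \<and> I \<subseteq> J \<and> J \<subseteq> K
    \<and> z \<in> I \<and> y \<in> J \<and> w \<in> K
    \<and> (\<forall>v\<in>I. \<not> lt z v) \<and> (\<forall>v\<in>J. \<not> lt y v) \<and> (\<forall>v\<in>K. \<not> lt w v)"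

text \<open>The layers between consecutive segments are ordered by arbitrary linear extensions;
  closedness of the segments makes the concatenation admissible.\<close>

lemma config_gaps:
  assumes fin: "finite S" and chain: "lt z y" "lt y w" and c: "config S y w I J K"
    and cards: "card J = card I + Suc a" "card K = card J + Suc b"
  shows "gaps S y w a b \<noteq> {}"
proof -
  have sub: "I \<subseteq> J" "J \<subseteq> K" "K \<subseteq> S" and zyw: "z \<in> I" "y \<in> J" "w \<in> K"
    and downs: "\<forall>v\<in>I. \<forall>u\<in>S. lt u v \<longrightarrow> u \<in> I" "\<forall>v\<in>J. \<forall>u\<in>S. lt u v \<longrightarrow> u \<in> J"
      "\<forall>v\<in>K. \<forall>u\<in>S. lt u v \<longrightarrow> u \<in> K"
    and top: "\<forall>v\<in>I. \<not> lt z v" "\<forall>v\<in>J. \<not> lt y v" "\<forall>v\<in>K. \<not> lt w v"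
    using c by (simp_all add: config_def down_def)
  have "finite K" by (rule finite_subset[OF sub(3) fin])
  moreover from this have "finite J" by (rule finite_subset[OF sub(2)])
  ultimately have finK: "finite I" "finite J" "finite K" using finite_subset[OF sub(1)] by auto
  have out: "y \<notin> I" "w \<notin> J" using top chain by auto
  obtain p q r s where e: "p \<in> exts (I - {z})" "q \<in> exts (J - I - {y})" "r \<in> exts (K - J - {w})" "s \<in> exts (S - K)"
    using exts_nonempty[of "I - {z}"] exts_nonempty[of "J - I - {y}"] exts_nonempty[of "K - J - {w}"]
      exts_nonempty[of "S - K"] fin finK by auto
  have sets: "set p = I - {z}" "set q = J - I - {y}" "set r = K - J - {w}" "set s = S - K"
    and d: "distinct p" "distinct q" "distinct r" "distinct s"
    and srt: "sorted_wrt (\<lambda>x y. \<not> lt y x) p" "sorted_wrt (\<lambda>x y. \<not> lt y x) q"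
      "sorted_wrt (\<lambda>x y. \<not> lt y x) r" "sorted_wrt (\<lambda>x y. \<not> lt y x) s"
    using e by (auto simp: exts_def)
  have set_eq: "set (p @ z # q @ y # r @ w # s) = S" using sets sub zyw by auto
  have distinct: "distinct (p @ z # q @ y # r @ w # s)" using sets sub zyw out d by auto
  have in_S: "z \<in> S" "y \<in> S" "w \<in> S" using sub zyw by auto
  have IJ: "\<not> lt v u" if "u \<in> I" "v \<in> S - I" for u v using that downs(1) by blast
  have JK: "\<not> lt v u" if "u \<in> J" "v \<in> S - J" for u v using that downs(2) by blast
  have KS: "\<not> lt v u" if "u \<in> K" "v \<in> S - K" for u v using that downs(3) by blast
  have mem: "set p \<subseteq> I" "set q \<subseteq> J" "set q \<subseteq> S - I" "set r \<subseteq> K" "set r \<subseteq> S - J" "set r \<subseteq> S - I" "set s \<subseteq> S - K"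
    "set s \<subseteq> S - J" "set s \<subseteq> S - I" "y \<in> S - I" "w \<in> S - I" "w \<in> S - J"
    using sets sub zyw in_S out by auto
  have "sorted_wrt (\<lambda>x y. \<not> lt y x) (r @ w # s)"
    by (simp add: sorted_wrt_append srt) (use mem(4,7) zyw(3) top(3) KS in blast)
  then have "sorted_wrt (\<lambda>x y. \<not> lt y x) (q @ y # r @ w # s)"
    by (simp add: sorted_wrt_append[of _ q] srt) (use mem(2,5,8,12) zyw(2) top(2) JK in blast)
  then have "sorted_wrt (\<lambda>x y. \<not> lt y x) (p @ z # q @ y # r @ w # s)"
    by (simp add: sorted_wrt_append[of _ p] srt) (use mem(1,3,6,9,10,11) zyw(1) top(1) IJ in blast)
  then have "p @ z # q @ y # r @ w # s \<in> exts S" using set_eq distinct by (simp add: exts_def)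
  moreover have "length q = a"
  proof -
    have "card (J - I) = Suc a" using cards sub finK by (simp add: card_Diff_subset)
    moreover have "length q = card (J - I - {y})" by (rule length_exts[OF e(2)])
    ultimately show ?thesis using zyw out by simp
  qed
  moreover have "length r = b"
  proof -
    have "card (K - J) = Suc b" using cards sub finK by (simp add: card_Diff_subset)
    moreover have "length r = card (K - J - {w})" by (rule length_exts[OF e(3)])
    ultimately show ?thesis using zyw out by simp
  qed
  ultimately show ?thesis by (auto simp: gaps_def)
qed

lemma prefix_down:
  assumes "xs @ ys \<in> exts S"
  shows "down S (set xs)"
  using assms unfolding down_def exts_def by (auto simp: sorted_wrt_append)

lemma gaps_config:
  assumes "gaps S y w a b \<noteq> {}"
  obtains I J K where "config S y w I J K" "card J = card I + Suc a" "card K = card J + Suc b"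
proof -
  obtain p q r s where e: "p @ z # q @ y # r @ w # s \<in> exts S" and len: "length q = a" "length r = b"
    using assms by (auto simp: gaps_def)
  let ?I = "set (p @ [z])" and ?J = "set (p @ z # q @ [y])" and ?K = "set (p @ z # q @ y # r @ [w])"
  have dist: "distinct (p @ [z])" "distinct (p @ z # q @ [y])" "distinct (p @ z # q @ y # r @ [w])"
    using e by (auto simp: exts_def)
  have "down S ?I" "down S ?J" "down S ?K"
    using prefix_down[of "p @ [z]" "q @ y # r @ w # s" S] prefix_down[of "p @ z # q @ [y]" "r @ w # s" S]
      prefix_down[of "p @ z # q @ y # r @ [w]" s S] e by simp_all
  moreover have "\<forall>v\<in>?I. \<not> lt z v" "\<forall>v\<in>?J. \<not> lt y v" "\<forall>v\<in>?K. \<not> lt w v"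
    using e lt_irrefl by (auto simp: exts_def sorted_wrt_append)
  ultimately have "config S y w ?I ?J ?K" unfolding config_def by auto
  moreover have "card ?J = card ?I + Suc a" "card ?K = card ?J + Suc b"
    unfolding distinct_card[OF dist(1)] distinct_card[OF dist(2)] distinct_card[OF dist(3)] using len by simp_all
  ultimately show ?thesis by (rule that)
qed

lemma down_insert:
  assumes "finite S" "down S I" "down S M" "\<not> M \<subseteq> I"
  obtains u where "u \<in> M - I" "down S (insert u I)"
proof -
  have "finite (M - I)" "M - I \<noteq> {}" using assms finite_subset[of M S] by (auto simp: down_def)
  then obtain u where u: "u \<in> M - I" "\<And>y. y \<in> M - I \<Longrightarrow> \<not> lt y u" using ex_minimal[of "M - I"] by metis
  have "down S (insert u I)" using u assms(2,3) unfolding down_def by blast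
  then show ?thesis using that u by blast
qed

lemma down_remove:
  assumes "finite S" "down S J" "down S I" "\<not> J \<subseteq> I"
  obtains u where "u \<in> J - I" "down S (J - {u})" "\<And>v. v \<in> J \<Longrightarrow> \<not> lt u v"
proof -
  have "finite (J - I)" "J - I \<noteq> {}" using assms finite_subset[of J S] by (auto simp: down_def)
  then obtain u where u: "u \<in> J - I" "\<And>y. y \<in> J - I \<Longrightarrow> \<not> lt u y" using ex_maximal[of "J - I"] by metis
  have max: "\<not> lt u v" if "v \<in> J" for v using u that assms(2,3) unfolding down_def by blast
  then have "down S (J - {u})" using assms(2) unfolding down_def by blast
  then show ?thesis using that u max by blast
qed

text \<open>Lowers the first gap by one and raises the second by one, using the spare room in
  \<open>between\<close>. Its contrapositive bounds \<open>card (between S y w)\<close> when the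
  target gaps do not occur.\<close>

lemma gaps_exchange:
  assumes fin: "finite S" and yS: "y \<in> S" and chain: "lt z y" "lt y w"
    and g1: "gaps S y w a b' \<noteq> {}" and g2: "gaps S y w (Suc a) (Suc b) \<noteq> {}"
    and B: "card (between S y w) \<ge> b + 2"
  shows "gaps S y w a (b + 2) \<noteq> {}"
proof -
  \<comment> \<open>\<open>m\<close> is the least possible \<open>J\<close>, while \<open>M1\<close>
    and \<open>M3\<close> are the largest possible \<open>I\<close> and \<open>K\<close>.\<close>
  define m where "m = {u \<in> S. u = y \<or> lt u y}"
  define M1 where "M1 = {v \<in> S. \<not> lt z v}"
  define M3 where "M3 = {v \<in> S. \<not> lt w v}"
  have dm: "down S m" "down S M1" "down S M3"
    unfolding m_def M1_def M3_def down_def using lt_trans by blast+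
  have down_simps: "down S A \<Longrightarrow> down S A' \<Longrightarrow> down S (A \<union> A')" "down S A \<Longrightarrow> down S A' \<Longrightarrow> down S (A \<inter> A')" for A A'
    unfolding down_def by blast+
  have down_sub: "down S A \<Longrightarrow> A \<subseteq> S" for A by (simp add: down_def)
  have finD: "finite A" if "down S A" for A using down_sub[OF that] fin finite_subset by blast
  have mJ: "m \<subseteq> J" "I \<subseteq> M1" "K \<subseteq> M3" if "config S y w I J K" for I J K
    using that unfolding config_def m_def M1_def M3_def down_def by blast+
  have cardB: "card M3 \<ge> card m + (b + 3)"
  proof -
    have "m \<subseteq> M3" using chain lt_trans lt_irrefl unfolding m_def M3_def by blast
    moreover have "M3 - m = insert w (between S y w)" if "w \<in> S"
      using that chain lt_irrefl lt_trans unfolding m_def M3_def between_def by blast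
    moreover have "w \<in> S" using g2 by (auto simp: gaps_def exts_def)
    moreover have "finite (between S y w)" "w \<notin> between S y w" using fin by (auto simp: between_def)
    ultimately have "card M3 - card m = Suc (card (between S y w))"
      using finD[OF dm(1)] by (metis card_Diff_subset card_insert_disjoint)
    then show ?thesis using B by simp
  qed
  obtain I0 J0 K0 where c0: "config S y w I0 J0 K0" "card J0 = card I0 + Suc a"
    by (rule gaps_config[OF g1])
  have m_M1: "card (m - M1) \<le> Suc a"
  proof -
    have "m - M1 \<subseteq> J0 - I0" using mJ[OF c0(1)] by blast
    moreover have "finite J0" "I0 \<subseteq> J0" using c0 finD by (auto simp: config_def)
    moreover have "finite I0" using c0 finD by (auto simp: config_def)
    ultimately show ?thesis using c0(2) card_mono[of "J0 - I0" "m - M1"] by (simp add: card_Diff_subset)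
  qed
  \<comment> \<open>The configuration from \<open>g1\<close> gives \<open>m - M1\<close> at most
    \<open>a + 1\<close> elements. If \<open>m - I\<close> is larger, \<open>I\<close> can grow
    inside \<open>m\<close> without enlarging \<open>I \<union> m\<close>.\<close>
  have advance: "\<exists>u. u \<notin> I \<and> config S y w (insert u I) (I \<union> m) K"
    if c: "config S y w I (I \<union> m) K" and big: "card (m - I) > Suc a" for I K
  proof -
    have "\<not> m \<inter> M1 \<subseteq> I"
    proof
      assume "m \<inter> M1 \<subseteq> I"
      then have "m - I \<subseteq> m - M1" by blast
      then show False using big m_M1 card_mono[of "m - M1" "m - I"] finD[OF dm(1)] by simp
    qed
    moreover have "down S I" using c by (simp add: config_def)
    ultimately obtain u where u: "u \<in> m \<inter> M1 - I" "down S (insert u I)"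
      using down_insert[OF fin _ down_simps(2)[OF dm(1,2)]] by metis
    then have "config S y w (insert u I) (I \<union> m) K"
      using c unfolding config_def M1_def by blast
    then show ?thesis using u by blast
  qed
  obtain I J K where c: "config S y w I J K" and card: "card J = card I + Suc (Suc a)" "card K = card J + Suc (Suc b)"
    by (rule gaps_config[OF g2])
  have d: "down S I" "down S J" "down S K" and sub: "I \<subseteq> J" "J \<subseteq> K" and zyw: "z \<in> I" "y \<in> J" "w \<in> K"
    using c by (auto simp: config_def)
  have fins: "finite I" "finite J" "finite K" using finD d by auto
  have ym: "y \<in> m" "z \<in> m" using yS chain zyw d(1) by (auto simp: m_def down_def)
  show ?thesis
  proof (cases "J \<subseteq> I \<union> m")
    case False
    \<comment> \<open>Some element of \<open>J\<close> is forced neither by \<open>I\<close> nor by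
      \<open>y\<close>; it moves behind \<open>y\<close>.\<close>
    then obtain u where u: "u \<in> J - (I \<union> m)" "down S (J - {u})"
      using down_remove[OF fin d(2) down_simps(1)[OF d(1) dm(1)]] by metis
    have "config S y w I (J - {u}) K" using c u ym unfolding config_def by blast
    moreover have "card (J - {u}) = card I + Suc a" "card K = card (J - {u}) + Suc (b + 2)"
      using card u fins by (simp_all add: card_Diff_singleton)
    ultimately show ?thesis by (rule config_gaps[OF fin chain])
  next
    case True
    then have J: "J = I \<union> m" using sub mJ(1)[OF c] by blast
    have cmI: "card (m - I) = Suc (Suc a)"
    proof -
      have "card (J - I) = Suc (Suc a)" using card sub fins by (simp add: card_Diff_subset)
      moreover have "J - I = m - I" using J by blast
      ultimately show ?thesis by simp
    qed
    show ?thesis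
    proof (cases "M3 \<subseteq> K")
      case False
      \<comment> \<open>\<open>J\<close> is kept: \<open>I\<close> advances by one element and
        \<open>K\<close> takes in one more.\<close>
      obtain v where v: "v \<in> M3 - K" "down S (insert v K)" by (rule down_insert[OF fin d(3) dm(3) False])
      obtain u where u: "u \<notin> I" "config S y w (insert u I) J K"
        using advance[of I K] c cmI J by auto
      have "config S y w (insert u I) J (insert v K)"
        using u(2) v unfolding config_def M3_def by blast
      moreover have "card J = card (insert u I) + Suc a" "card (insert v K) = card J + Suc (b + 2)"
        using card u v fins by simp_all
      ultimately show ?thesis by (rule config_gaps[OF fin chain])
    next
      case True
      then have K: "K = M3" using mJ(3)[OF c] by blast
      \<comment> \<open>\<open>K\<close> is already maximal, so the size of \<open>between\<close>
        forces \<open>J\<close> to exceed \<open>m\<close>. An element outside \<open>m\<close>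
        leaves both \<open>I\<close> and \<open>J\<close>, and then \<open>I\<close>
        advances.\<close>
      have "\<not> J \<subseteq> m"
      proof
        assume "J \<subseteq> m"
        then have "card J \<le> card m" using finD[OF dm(1)] by (rule card_mono[rotated])
        then show False using card cardB K by simp
      qed
      then obtain u where u: "u \<in> J - m" "down S (J - {u})" "\<And>v. v \<in> J \<Longrightarrow> \<not> lt u v"
        using down_remove[OF fin d(2) dm(1)] by metis
      have uI: "u \<in> I" using u J by blast
      have "down S (I - {u})" using d(1) u(3) sub unfolding down_def by blast
      moreover have J': "J - {u} = (I - {u}) \<union> m" using J u by blast
      ultimately have c': "config S y w (I - {u}) ((I - {u}) \<union> m) K"
        using c u ym unfolding config_def J'[symmetric] by blast
      moreover have "m - (I - {u}) = m - I" using u by blast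
      ultimately obtain v where v: "v \<notin> I - {u}" "config S y w (insert v (I - {u})) (J - {u}) K"
        using advance[of "I - {u}" K] cmI unfolding J' by auto
      have "card I \<ge> 1" using uI fins by (metis One_nat_def Suc_leI card_gt_0_iff empty_iff)
      then have "card (J - {u}) = card (insert v (I - {u})) + Suc a" "card K = card (J - {u}) + Suc (b + 2)"
        using card u uI v fins by (simp_all add: card_Diff_singleton)
      then show ?thesis by (rule config_gaps[OF fin chain v(2)])
    qed
  qed
qed

text \<open>Every suffix with gap \<open>b + 1\<close> uses up \<open>between\<close> and leaves
  \<open>Q\<close>; one with gap \<open>b\<close> leaves \<open>Q\<close> or \<open>Q\<close> with
  one extra element. So the larger gap contributes the common factor \<open>W\<close>, and the
  inequality is proved suffix by suffix and summed.\<close>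

lemma card_gaps_cross:
  assumes fin: "finite S" and zyw: "z \<in> S" "y \<in> S" "w \<in> S" and chain: "lt z y" "lt y w" and t: "t \<ge> 1"
    and thin_flat: "thin_wrt S lt t {z, y, w} \<or> flat_wrt S lt t {z, y, w}"
    and empty: "gaps S y w a (b + 2) = {}"
  shows "real (card (gaps S y w (a + 1) b)) * real (card (gaps S y w a (b + 1)))
    \<ge> real (card (gaps S y w a b)) * real (card (gaps S y w (a + 1) (b + 1)))
      * (1 / 2 + 1 / (8 * real (min (a + 1) t * t)))"
proof (cases "gaps S y w a b = {} \<or> gaps S y w (a + 1) (b + 1) = {}")
  case True
  then show ?thesis by auto
next
  case False
  define Q where "Q = {x \<in> S. lt x y}"
  define W where "W = real (card (suffixes S y w (b + 1)))"
  define \<theta> where "\<theta> = 1 / 2 + 1 / (8 * real (min (a + 1) t * t))"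
  have theta: "0 \<le> \<theta>" "\<theta> \<le> 1"
  proof -
    have "min (a + 1) t * t \<ge> 1" using t by simp
    then have "real (min (a + 1) t * t) \<ge> 1" by linarith
    then show "\<theta> \<le> 1" "0 \<le> \<theta>" unfolding \<theta>_def by (simp_all add: field_simps)
  qed
  have B: "card (between S y w) \<le> b + 1"
    using gaps_exchange[OF fin zyw(2) chain, of a b b] False empty by fastforce
  have finB: "finite (between S y w)" using fin by (simp add: between_def)
  have rest_full: "rest S y w rs = Q" if "rs \<in> suffixes S y w (b + 1)" for rs
  proof -
    obtain r s where rs: "rs = (r, s)" by (cases rs)
    note suf = suffixes_rest[OF fin chain, of r s "b + 1"]
    have "set r = between S y w"
      using suf(1,2) that rs B finB by (intro card_seteq) auto
    then show ?thesis using suf(3,4) that rs by (auto simp: Q_def)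
  qed
  have full: "real (card (gaps S y w m (b + 1))) = W * real (cnt Q m)" for m
    unfolding card_gaps[OF fin] by (simp add: rest_full W_def)
  have ratio: "real (cnt (rest S y w rs) a) * real (cnt Q (a + 1)) * \<theta>
    \<le> real (cnt (rest S y w rs) (a + 1)) * real (cnt Q a)" if mem: "rs \<in> suffixes S y w b" for rs
  proof -
    obtain r s where rs: "rs = (r, s)" by (cases rs)
    define T where "T = rest S y w rs"
    have suf: "set r \<subseteq> between S y w" "card (set r) = b" "Q \<subseteq> T" "T \<subseteq> Q \<union> (between S y w - set r)"
      using suffixes_rest[OF fin chain, of r s b] mem rs by (simp_all add: T_def Q_def)
    have "card (between S y w - set r) \<le> 1"
      using suf(1,2) B by (simp add: card_Diff_subset)
    then consider "T = Q" | x where "T = insert x Q" "x \<in> between S y w" "x \<notin> Q"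
      using suf(3,4) finB by (auto simp: card_le_Suc0_iff_eq) blast
    then show ?thesis
    proof cases
      case 1
      have "real (cnt Q a) * real (cnt Q (a + 1)) * \<theta> \<le> real (cnt Q a) * real (cnt Q (a + 1)) * 1"
        using theta by (intro mult_left_mono) auto
      then show ?thesis unfolding T_def[symmetric] 1 by (simp only: mult_ac mult_1_right)
    next
      case (2 x)
      have zQ: "z \<in> Q" using zyw chain by (simp add: Q_def)
      have xz: "x \<noteq> z" using 2 zQ by auto
      have finT: "finite T" using fin by (simp add: T_def rest_def)
      have Tsub: "T \<subseteq> S - {y, w}" by (auto simp: T_def rest_def)
      have "\<not> lt x u" if "u \<in> T" for u
        using that 2 lt_trans lt_irrefl unfolding Q_def between_def by blast
      then have ends: "(x, True) \<in> ends T" using 2 xz by (simp add: ends_def)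
      have small: "card T \<le> t \<or> (\<forall>u\<in>T - {z}. card {v \<in> T. incomparable lt u v} \<le> t)"
        using thin_flat
      proof
        assume thin: "thin_wrt S lt t {z, y, w}"
        have "card {v \<in> T. incomparable lt u v} \<le> t" if "u \<in> T - {z}" for u
        proof -
          have "card {v \<in> T. incomparable lt u v} \<le> card {v \<in> S. incomparable lt u v}"
            using Tsub fin by (intro card_mono) auto
          also have "\<dots> \<le> t" using thin that Tsub by (auto simp: thin_wrt_def)
          finally show ?thesis .
        qed
        then show ?thesis by blast
      next
        assume flat: "flat_wrt S lt t {z, y, w}"
        have "w \<notin> Q" using chain lt_trans lt_irrefl by (auto simp: Q_def)
        \<comment> \<open>\<open>w\<close> stands in for \<open>x\<close>: all of \<open>Q\<close>
          lies below \<open>y\<close> and \<open>w\<close> lies above it, so flatness at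
          \<open>y\<close> bounds \<open>card T\<close>.\<close>
        have "card T = card (insert w Q)" using 2 \<open>w \<notin> Q\<close> fin by (simp add: Q_def)
        also have "\<dots> \<le> card {v \<in> S. comparable lt y v}"
          using fin zyw chain by (intro card_mono) (auto simp: Q_def comparable_def)
        also have "\<dots> \<le> t" using flat by (simp add: flat_wrt_def)
        finally show ?thesis by simp
      qed
      have "T - {x} = Q" using 2 by auto
      then show ?thesis
        using cnt_ratio[OF finT _ ends t small, of a] zQ suf(3) unfolding T_def[symmetric] \<theta>_def by auto
    qed
  qed
  have part: "real (card (gaps S y w m b)) = (\<Sum>rs\<in>suffixes S y w b. real (cnt (rest S y w rs) m))" for m
    unfolding card_gaps[OF fin] by simp
  have "real (card (gaps S y w a b)) * real (card (gaps S y w (a + 1) (b + 1))) * \<theta>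
    = W * (\<Sum>rs\<in>suffixes S y w b. real (cnt (rest S y w rs) a) * real (cnt Q (a + 1)) * \<theta>)"
    unfolding full part by (simp add: sum_distrib_left sum_distrib_right mult_ac)
  also have "\<dots> \<le> W * (\<Sum>rs\<in>suffixes S y w b. real (cnt (rest S y w rs) (a + 1)) * real (cnt Q a))"
    using ratio by (intro mult_left_mono sum_mono) (auto simp: W_def)
  also have "\<dots> = real (card (gaps S y w (a + 1) b)) * real (card (gaps S y w a (b + 1)))"
    unfolding full part by (simp add: sum_distrib_left sum_distrib_right mult_ac)
  finally show ?thesis unfolding \<theta>_def .
qed

end

theorem theorem6p6:
  fixes X :: "'a set" and lt :: "'a \<Rightarrow> 'a \<Rightarrow> bool" and z1 z2 z3 :: 'a
    and t k l :: nat and F :: "nat \<Rightarrow> nat \<Rightarrow> real"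
  defines "F \<equiv> \<lambda>a b. real (gap_count X lt z1 z2 z3 a b)"
  assumes poset: "finite_strict_poset X lt"
    and z_in: "z1 \<in> X" "z2 \<in> X" "z3 \<in> X"
    and z_distinct: "distinct [z1, z2, z3]"
    and z_chain: "lt z1 z2" "lt z2 z3"
    and t_pos: "t \<ge> 1"
    and thin_or_flat: "thin_wrt X lt t {z1, z2, z3} \<or> flat_wrt X lt t {z1, z2, z3}"
    and kl_pos: "k \<ge> 1" "l \<ge> 1"
    and F_zero: "F k (l + 2) = 0"
    and F_pos: "F (k + 2) l > 0"
  shows "F (k + 1) l * F k (l + 1) \<ge>
    F k l * F (k + 1) (l + 1) *
      max (1 / 2 + 1 / (16 * real k * real l * (real l + 1) * real t))
          (1 / 2 + 1 / (16 * real t * (real t + 1) ^ 3))"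
proof -
  \<comment> \<open>The locale needs the order laws on the whole type, so the relation is cut down
    to \<open>X\<close>.\<close>
  define lt' where "lt' u v \<longleftrightarrow> u \<in> X \<and> v \<in> X \<and> lt u v" for u v
  have fin: "finite X" and irrefl: "\<And>u. u \<in> X \<Longrightarrow> \<not> lt u u"
    and trans: "\<And>u v w. u \<in> X \<Longrightarrow> v \<in> X \<Longrightarrow> w \<in> X \<Longrightarrow> lt u v \<Longrightarrow> lt v w \<Longrightarrow> lt u w"
    using poset by (auto simp: finite_strict_poset_def irreflp_on_def dest: transp_onD)
  interpret marked_order lt' z1
    by unfold_locales (use irrefl trans in \<open>auto simp: lt'_def\<close>)
  have "linear_extensions X lt = linear_extensions X lt'"
    by (auto simp: linear_extensions_def lt'_def)
  then have count: "F (Suc a) (Suc b) = real (card (gaps X z2 z3 a b))" for a b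
    using gap_count_eq_card_gaps[OF fin z_in, of a b] by (simp add: F_def gap_count_def)
  have "{v \<in> X. incomparable lt u v} = {v \<in> X. incomparable lt' u v}"
    "{v \<in> X. comparable lt u v} = {v \<in> X. comparable lt' u v}" if "u \<in> X" for u
    using that by (auto simp: incomparable_def comparable_def lt'_def)
  then have small: "thin_wrt X lt' t {z1, z2, z3} \<or> flat_wrt X lt' t {z1, z2, z3}"
    using thin_or_flat z_in by (simp add: thin_wrt_def flat_wrt_def)
  obtain a b where kl: "k = Suc a" "l = Suc b" using kl_pos by (metis Suc_le_D One_nat_def)
  have "gaps X z2 z3 a (b + 2) = {}"
  proof -
    have "finite (gaps X z2 z3 a (b + 2))"
      by (rule finite_subset[OF _ finite_cartesian_product[OF _ finite_cartesian_product[OF _ finite_cartesian_product]],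
        of _ "{xs. set xs \<subseteq> X \<and> distinct xs}" "{xs. set xs \<subseteq> X \<and> distinct xs}" "{xs. set xs \<subseteq> X \<and> distinct xs}" "{xs. set xs \<subseteq> X \<and> distinct xs}"])
        (use fin in \<open>auto simp: gaps_def exts_def finite_subset_distinct\<close>)
    then show ?thesis using F_zero count[of a "b + 2"] kl by simp
  qed
  then have main: "F (k + 1) l * F k (l + 1) \<ge> F k l * F (k + 1) (l + 1) * (1 / 2 + 1 / (8 * real (min k t * t)))"
    using card_gaps_cross[OF fin z_in _ _ t_pos small, of a b] z_chain z_in
    by (simp add: kl count lt'_def)
  have pos: "8 * real (min k t * t) > 0" using t_pos kl_pos by simp
  have A1: "8 * real (min k t * t) \<le> 16 * real k * real l * (real l + 1) * real t"
  proof -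
    have "8 * (min k t * t) \<le> 8 * (k * t)" by simp
    also have "\<dots> \<le> 8 * (k * t) * (2 * l * (l + 1))" using kl_pos by simp
    also have "\<dots> = 16 * k * l * (l + 1) * t" by (simp add: algebra_simps)
    finally have "real (8 * (min k t * t)) \<le> real (16 * k * l * (l + 1) * t)" by (simp only: of_nat_le_iff)
    then show ?thesis by (simp only: of_nat_mult of_nat_add of_nat_numeral of_nat_1)
  qed
  have A2: "8 * real (min k t * t) \<le> 16 * real t * (real t + 1) ^ 3"
  proof -
    have "min k t * t \<le> t * t" by simp
    then have "8 * (min k t * t) \<le> 16 * t * (t + 1)" unfolding distrib_left by linarith
    also have "\<dots> \<le> 16 * t * (t + 1) ^ 3" by (intro mult_left_mono self_le_power) auto
    finally have "real (8 * (min k t * t)) \<le> real (16 * t * (t + 1) ^ 3)" by (simp only: of_nat_le_iff)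
    then show ?thesis by (simp add: add.commute)
  qed
  \<comment> \<open>Both denominators are at least \<open>8 * min k t * t\<close>, by
    \<open>min k t \<le> k\<close> and \<open>min k t \<le> t\<close> respectively, so the sharper
    constant dominates both.\<close>
  have "max (1 / 2 + 1 / (16 * real k * real l * (real l + 1) * real t))
      (1 / 2 + 1 / (16 * real t * (real t + 1) ^ 3)) \<le> 1 / 2 + 1 / (8 * real (min k t * t))"
    by (intro max.boundedI add_left_mono frac_le[OF _ _ pos A1] frac_le[OF _ _ pos A2]) simp_all
  then have "F k l * F (k + 1) (l + 1) *
      max (1 / 2 + 1 / (16 * real k * real l * (real l + 1) * real t))
          (1 / 2 + 1 / (16 * real t * (real t + 1) ^ 3))
    \<le> F k l * F (k + 1) (l + 1) * (1 / 2 + 1 / (8 * real (min k t * t)))"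
    by (intro mult_left_mono) (auto simp: F_def)
  then show ?thesis using main by linarith
qed

end
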